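(* Let $\beta=\alpha\ge-\frac12$ and let $c>0$. Assume that $f$ is the restriction to $I=[-1,1]$ of a $c$-bandlimited function $\overline f$, i.e. $\overline f\in L^2(\mathbb R)$ with Fourier transform supported in $[-c,c]$. Consider observations $Y_i=f(X_i)+\varepsilon_i$, $1\le i\le n$, where $X_1,\dots,X_n$ are i.i.d. with the Beta $B(\alpha+1,\beta+1)$ distribution on $I$ and the $\varepsilon_i$ are i.i.d. centered real random variables with variance $\sigma^2$; let $\pmb\eta_n=\max_{1\le i\le n}|\varepsilon_i|$ and let $\widehat f_{n,N}$ be the least squares estimator defined in the context. Then there is a constant $C_\alpha$ such that, setting $$\eta_N^{(\alpha)}=c^{-1/2}C_\alpha\Big(\frac{ec}{2N+2}\Big)^{N+2},$$ for any $0<\delta<1$ there is a constant $C>0$ independent of $n,N$ such that, for all sufficiently large $n,N$ with $n>N$ and $0.63\,n>m_{\alpha,\beta}^2(N+1)^{2\alpha+2}\log(N+1)$, with probability at least $(1-\delta)^2$, $$\|f-\widehat f_{n,N}\|_\omega\le C\left(\eta_N^{(\alpha)}\|\overline f\|_{L^2(\mathbb R)}+\sqrt{2\kappa_2(A_N)}\;\frac{\Big(\frac1n\log\big(\frac2\delta\big)\Big)^{1/4}+\frac{\eta_N^{(\alpha)}\|\overline f\|_{L^2(\mathbb R)}}{\sqrt{\gamma_{\alpha,\beta}}}+\pmb\eta_n}{\frac{1}{\sqrt{\gamma_{\alpha,\beta}}}-2\Big(\frac1n\log\big(\frac2\delta\big)\Big)^{1/4}\frac{\|f\|_\infty}{\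|f\|_\omega}}\right).$$
   Context: $I=[-1,1]$, $\omega_{\alpha,\beta}(x)=(1-x)^\alpha(1+x)^\beta$, $\|f\|_\omega^2=\int_I|f|^2\omega_{\alpha,\beta}\,dx$, $\|\cdot\|_\infty$ is the sup norm on $I$. The Jacobi polynomials are $P_k^{(\alpha,\beta)}(x)=\frac{(-1)^k}{2^k k!}\frac{1}{\omega_{\alpha,\beta}(x)}\frac{d^k}{dx^k}\big(\omega_{\alpha,\beta}(x)(1-x^2)^k\big)$, and the normalized ones are $\widetilde P^{(\alpha,\beta)}_k=P^{(\alpha,\beta)}_k/\sqrt{h_k^{\alpha,\beta}}$ with $h_k^{\alpha,\beta}=\frac{2^{\alpha+\beta+1}\Gamma(k+\alpha+1)\Gamma(k+\beta+1)}{k!(2k+\alpha+\beta+1)\Gamma(k+\alpha+\beta+1)}$, so that $\|\widetilde P^{(\alpha,\beta)}_k\|_\omega=1$. The Beta $B(\alpha+1,\beta+1)$ distribution on $I$ has density $\omega_{\alpha,\beta}(x)/\gamma_{\alpha,\beta}$, with $\gamma_{\alpha,\beta}=2^{\alpha+\beta+1}B(\alpha+1,\beta+1)$, where $B(\cdot,\cdot)$ is the Beta function. Constants, with $\mu=\max(\alpha,\beta)$ ($=\alpha$ here): $c_{\alpha,\beta}=\frac{\alpha+\beta+1}{2}$, $\ \eta_{\alpha,\beta}=\frac{\exp\big(\frac{2\max(\mu,0)}{12}+\frac{\max(\mu^2+\alpha\beta,0)}{8}\big)}{2^{(\alpha+\beta)/2}\Gamma(\mu+1)}$, $\ m_{\alpha,\beta}^2=\frac{1+\frac12\sqrt{c_{\alpha,\beta}/2}}{\mu+3/2}\,\eta_{\alpha,\beta}^2$.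 Random matrices: $B_N=\big[\frac{1}{\sqrt n}\widetilde P^{(\alpha,\beta)}_{k-1}(X_j)\big]_{1\le j\le n,\,1\le k\le N+1}$ and $A_N=B_N'B_N$ ($'$ denotes transpose). $\kappa_2(A_N)$ is the $2$-norm condition number, i.e. $\lambda_{\max}(A_N)/\lambda_{\min}(A_N)$ ($+\infty$ if $A_N$ is singular). Estimator: $\widehat f_{n,N}(x)=\sum_{k=1}^{N+1}\widehat c_k\,\widetilde P^{(\alpha,\beta)}_{k-1}(x)$, where $\widehat{\pmb C}=(\widehat c_1,\dots,\widehat c_{N+1})'$ is the least squares solution of $B_N\widehat{\pmb C}=\frac{1}{\sqrt n}(Y_1,\dots,Y_n)'$, that is $\widehat{\pmb C}=(B_N'B_N)^{-1}B_N'\,\frac{1}{\sqrt n}(Y_1,\dots,Y_n)'$ when $A_N$ is invertible. *)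

theory Defs
  imports "HOL-Probability.Probability" "Jordan_Normal_Form.Char_Poly"
    "Jordan_Normal_Form.Gauss_Jordan_Elimination"
begin

section \<open>Jacobi polynomials and the weighted space\<close>

definition jacobi_weight :: "real \<Rightarrow> real \<Rightarrow> real \<Rightarrow> real" where
  "jacobi_weight \<alpha> \<beta> x = (1 - x) powr \<alpha> * (1 + x) powr \<beta>"

text \<open>Rodrigues' formula. It describes the polynomial on the open interval \<open>(-1, 1)\<close>; at the
  end points it need not return the value of the polynomial. The two end points are a null set for
  the weighted norm and for the Beta law, the only ways in which these functions are used.\<close>

definition jacobi :: "real \<Rightarrow> real \<Rightarrow> nat \<Rightarrow> real \<Rightarrow> real" where
  "jacobi \<alpha> \<beta> k x = (-1) ^ k / (2 ^ k * fact k) * (1 / jacobi_weight \<alpha> \<beta> x)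
     * (deriv ^^ k) (\<lambda>t. jacobi_weight \<alpha> \<beta> t * (1 - t\<^sup>2) ^ k) x"

text \<open>For \<open>k = 0\<close> the factor \<open>(\<alpha> + \<beta> + 1) \<Gamma>(\<alpha> + \<beta> + 1)\<close> of the general formula is written as
  \<open>\<Gamma>(\<alpha> + \<beta> + 2)\<close>. This only matters for \<open>\<alpha> + \<beta> = -1\<close>, where the general expression is
  \<open>0 \<cdot> \<Gamma>(0)\<close> and has to be read as its limit \<open>1\<close>.\<close>

definition jacobi_h :: "real \<Rightarrow> real \<Rightarrow> nat \<Rightarrow> real" where
  "jacobi_h \<alpha> \<beta> k =
     (if k = 0
      then 2 powr (\<alpha> + \<beta> + 1) * Gamma (\<alpha> + 1) * Gamma (\<beta> + 1) / Gamma (\<alpha> + \<beta> + 2)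
      else 2 powr (\<alpha> + \<beta> + 1) * Gamma (real k + \<alpha> + 1) * Gamma (real k + \<beta> + 1)
             / (fact k * (2 * real k + \<alpha> + \<beta> + 1) * Gamma (real k + \<alpha> + \<beta> + 1)))"

definition jacobi_normalized :: "real \<Rightarrow> real \<Rightarrow> nat \<Rightarrow> real \<Rightarrow> real" where
  "jacobi_normalized \<alpha> \<beta> k x = jacobi \<alpha> \<beta> k x / sqrt (jacobi_h \<alpha> \<beta> k)"

definition weighted_norm :: "real \<Rightarrow> real \<Rightarrow> (real \<Rightarrow> real) \<Rightarrow> real" where
  "weighted_norm \<alpha> \<beta> f = sqrt (LINT x:{-1..1}|lborel. \<bar>f x\<bar>\<^sup>2 * jacobi_weight \<alpha> \<beta> x)"

definition sup_norm :: "(real \<Rightarrow> real) \<Rightarrow> real" where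
  "sup_norm f = (SUP x\<in>{-1..1}. \<bar>f x\<bar>)"


section \<open>Bandlimited functions\<close>

definition square_integrable :: "(real \<Rightarrow> 'a::{banach, second_countable_topology}) \<Rightarrow> bool" where
  "square_integrable g \<longleftrightarrow>
     g \<in> borel_measurable lborel \<and> integrable lborel (\<lambda>x. (norm (g x))\<^sup>2)"

definition L2_norm_real :: "(real \<Rightarrow> real) \<Rightarrow> real" where
  "L2_norm_real g = sqrt (LINT x|lborel. \<bar>g x\<bar>\<^sup>2)"

text \<open>\<open>F\<close> is a representative of the Fourier--Plancherel transform of \<open>g\<close>: the truncated Fourier
  integrals of \<open>g\<close> converge to \<open>F\<close> in \<open>L\<^sup>2\<close>. The convention is
  \<open>F(\<xi>) = \<integral> g(x) exp(- \<i> x \<xi>) dx\<close>.\<close>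

definition is_fourier_transform :: "(real \<Rightarrow> real) \<Rightarrow> (real \<Rightarrow> complex) \<Rightarrow> bool" where
  "is_fourier_transform g F \<longleftrightarrow> square_integrable g \<and> square_integrable F \<and>
     ((\<lambda>R. \<integral>\<^sup>+ \<xi>. ennreal ((cmod ((LINT x:{-R..R}|lborel.
               exp (- (\<i> * complex_of_real (x * \<xi>))) * complex_of_real (g x)) - F \<xi>))\<^sup>2)
             \<partial>lborel) \<longlongrightarrow> 0) at_top"

text \<open>A function in \<open>L\<^sup>2\<close> with compactly supported Fourier transform is an equivalence class which
  has exactly one continuous representative. Point values and the sup norm refer to it, hence
  the continuity requirement.\<close>

definition bandlimited :: "real \<Rightarrow> (real \<Rightarrow> real) \<Rightarrow> bool" where
  "bandlimited c g \<longleftrightarrow> continuous_on UNIV g \<and> square_integrable g \<and>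
     (\<exists>F. is_fourier_transform g F \<and> (AE \<xi> in lborel. \<xi> \<notin> {-c..c} \<longrightarrow> F \<xi> = 0))"


section \<open>Constants\<close>

definition gamma_const :: "real \<Rightarrow> real \<Rightarrow> real" where
  "gamma_const \<alpha> \<beta> = 2 powr (\<alpha> + \<beta> + 1) * Beta (\<alpha> + 1) (\<beta> + 1)"

definition c_const :: "real \<Rightarrow> real \<Rightarrow> real" where
  "c_const \<alpha> \<beta> = (\<alpha> + \<beta> + 1) / 2"

definition eta_const :: "real \<Rightarrow> real \<Rightarrow> real" where
  "eta_const \<alpha> \<beta> =
     (let \<mu> = max \<alpha> \<beta> in
      exp (2 * max \<mu> 0 / 12 + max (\<mu>\<^sup>2 + \<alpha> * \<beta>) 0 / 8)
        / (2 powr ((\<alpha> + \<beta>) / 2) * Gamma (\<mu> + 1)))"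

definition m_squared :: "real \<Rightarrow> real \<Rightarrow> real" where
  "m_squared \<alpha> \<beta> =
     (let \<mu> = max \<alpha> \<beta> in
      (1 + 1 / 2 * sqrt (c_const \<alpha> \<beta> / 2)) / (\<mu> + 3 / 2) * (eta_const \<alpha> \<beta>)\<^sup>2)"

definition bandlimited_rate :: "real \<Rightarrow> real \<Rightarrow> nat \<Rightarrow> real" where
  "bandlimited_rate C\<alpha> c N =
     c powr (- 1 / 2) * C\<alpha> * (exp 1 * c / (2 * real N + 2)) ^ (N + 2)"


section \<open>Random matrices and the least squares estimator\<close>

text \<open>Samples \<open>x\<^sub>1, \<dots>, x\<^sub>n\<close> are functions on \<open>nat\<close> used at the indices \<open>1, \<dots>, n\<close>, whereas
  matrix and vector indices start at \<open>0\<close>.\<close>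

definition design_matrix :: "real \<Rightarrow> real \<Rightarrow> nat \<Rightarrow> nat \<Rightarrow> (nat \<Rightarrow> real) \<Rightarrow> real mat" where
  "design_matrix \<alpha> \<beta> n N x =
     Matrix.mat n (N + 1) (\<lambda>(j, k). 1 / sqrt (real n) * jacobi_normalized \<alpha> \<beta> k (x (j + 1)))"

definition gram_matrix :: "real \<Rightarrow> real \<Rightarrow> nat \<Rightarrow> nat \<Rightarrow> (nat \<Rightarrow> real) \<Rightarrow> real mat" where
  "gram_matrix \<alpha> \<beta> n N x =
     transpose_mat (design_matrix \<alpha> \<beta> n N x) * design_matrix \<alpha> \<beta> n N x"

definition cond_number :: "real mat \<Rightarrow> ereal" where
  "cond_number A =
     (if invertible_mat A
      then ereal (Max (Collect (eigenvalue A)) / Min (Collect (eigenvalue A)))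
      else \<infinity>)"

definition ereal_sqrt :: "ereal \<Rightarrow> ereal" where
  "ereal_sqrt z = (case z of ereal r \<Rightarrow> ereal (sqrt r) | PInfty \<Rightarrow> \<infinity> | MInfty \<Rightarrow> -\<infinity>)"

text \<open>The value is unspecified if the Gram matrix is singular.\<close>

definition ls_coeffs ::
    "real \<Rightarrow> real \<Rightarrow> nat \<Rightarrow> nat \<Rightarrow> (nat \<Rightarrow> real) \<Rightarrow> (nat \<Rightarrow> real) \<Rightarrow> real Matrix.vec" where
  "ls_coeffs \<alpha> \<beta> n N x y =
     (the (mat_inverse (gram_matrix \<alpha> \<beta> n N x)) * transpose_mat (design_matrix \<alpha> \<beta> n N x))
       *\<^sub>v Matrix.vec n (\<lambda>j. 1 / sqrt (real n) * y (j + 1))"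

definition ls_estimator ::
    "real \<Rightarrow> real \<Rightarrow> nat \<Rightarrow> nat \<Rightarrow> (nat \<Rightarrow> real) \<Rightarrow> (nat \<Rightarrow> real) \<Rightarrow> real \<Rightarrow> real" where
  "ls_estimator \<alpha> \<beta> n N x y t =
     (\<Sum>k\<le>N. vec_index (ls_coeffs \<alpha> \<beta> n N x y) k * jacobi_normalized \<alpha> \<beta> k t)"


section \<open>The sampling model\<close>

definition beta_density :: "real \<Rightarrow> real \<Rightarrow> real \<Rightarrow> real" where
  "beta_density \<alpha> \<beta> x = indicator {-1..1} x * jacobi_weight \<alpha> \<beta> x / gamma_const \<alpha> \<beta>"

definition iid_beta ::
    "real \<Rightarrow> real \<Rightarrow> nat \<Rightarrow> 'a measure \<Rightarrow> (nat \<Rightarrow> 'a \<Rightarrow> real) \<Rightarrow> bool" where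
  "iid_beta \<alpha> \<beta> n M X \<longleftrightarrow>
     prob_space.indep_vars M (\<lambda>_. borel) X {1..n} \<and>
     (\<forall>i\<in>{1..n}. distributed M lborel (X i) (\<lambda>x. ennreal (beta_density \<alpha> \<beta> x)))"

definition iid_centered ::
    "real \<Rightarrow> nat \<Rightarrow> 'a measure \<Rightarrow> (nat \<Rightarrow> 'a \<Rightarrow> real) \<Rightarrow> bool" where
  "iid_centered \<sigma> n M \<epsilon> \<longleftrightarrow>
     prob_space.indep_vars M (\<lambda>_. borel) \<epsilon> {1..n} \<and>
     (\<forall>i\<in>{1..n}. \<forall>j\<in>{1..n}. distr M borel (\<epsilon> i) = distr M borel (\<epsilon> j)) \<and>
     (\<forall>i\<in>{1..n}. integrable M (\<lambda>\<omega>. (\<epsilon> i \<omega>)\<^sup>2) \<and>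
        prob_space.expectation M (\<epsilon> i) = 0 \<and> prob_space.variance M (\<epsilon> i) = \<sigma>\<^sup>2)"

end

(* The claimed bound holds on the event that no sample point hits an end point of [-1, 1], which has
   probability 1. Fourier inversion writes the bandlimited function as a superposition of the
   exponentials exp(i x xi), |xi| <= c; interpolating each of them at the N+1 Chebyshev nodes gives
   a polynomial p of degree at most N whose uniform error is of the order of the stated rate, by
   the interpolation remainder, Cauchy-Schwarz in xi and a lower Stirling bound. Since the
   normalized Jacobi polynomials are orthonormal and span the polynomials of degree at most N, the
   weighted distance from p to the estimator is the Euclidean distance of the coefficient vectors,
   which the least squares equations bound by (sup error + noise) / sqrt(lambda_min). Finally
   lambda_max is at least the first diagonal entry 1/gamma of the Gram matrix, so
   1/lambda_min <= gamma kappa. *)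
theory Submission
  imports Defs
begin

text \<open>The transform of \<open>fbar\<close> is given only as an L2 limit of truncated
  integrals, so the pointwise inversion formula needs Gaussian damping: tested against a damped
  exponential both sides make sense, and when the damping is removed the side of \<open>fbar\<close>
  converges by an approximate identity, which uses continuity, and the frequency side by dominated
  convergence.

  The exponent \<open>N + 2\<close> for \<open>N + 1\<close> nodes has this origin: the square root
  in Stirling's bound and the L2 norm of the power xi^(N+1) on [-c,c] together leave a factor
  1/(N+1). It completes one more power of ec/(2N+2), at the price of sqrt c / c = c^(-1/2).

  The constant \<open>C\<close> is chosen after \<open>c\<close> and \<open>fbar\<close>. Hence
  \<open>C\<alpha> = 1\<close> suffices, and the size of the transform need not be compared sharply
  with the norm of \<open>fbar\<close>. The estimate is made sample by sample: for large
  \<open>n\<close> the denominator is positive and at most 3/2 of its limit, and a singular Gram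
  matrix makes the right side infinite.\<close>

no_notation inner (infix "\<bullet>" 70)
no_notation vec_nth (infixl "$" 90)

section \<open>Extreme eigenvalues of real symmetric matrices\<close>

lemma vec_norm_sq_nonneg: "0 \<le> (v :: real Matrix.vec) \<bullet> v"
  by (auto simp: scalar_prod_def intro: sum_nonneg)

lemma vec_norm_sq_pos:
  assumes "v \<in> carrier_vec n" "v \<noteq> 0\<^sub>v n"
  shows "0 < (v :: real Matrix.vec) \<bullet> v"
proof -
  obtain i where "i < n" "v $ i \<noteq> 0"
    using assms by (metis eq_vecI carrier_vecD index_zero_vec(1) dim_vec index_zero_vec(2))
  then show ?thesis
    using assms unfolding scalar_prod_def
    by (intro sum_pos2[where i = i]) (auto simp: zero_less_mult_iff linorder_neq_iff)
qed

lemma scalar_prod_le_half_sum: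
  assumes "u \<in> carrier_vec n" "v \<in> carrier_vec n"
  shows "2 * (u \<bullet> v) \<le> (u :: real Matrix.vec) \<bullet> u + v \<bullet> v"
proof -
  have "0 \<le> (u - v) \<bullet> (u - v)" by (rule vec_norm_sq_nonneg)
  also have "\<dots> = u \<bullet> u + v \<bullet> v - 2 * (u \<bullet> v)"
    using assms
    by (simp add: minus_scalar_prod_distrib[of _ n] scalar_prod_minus_distrib[of _ n]
        comm_scalar_prod[of v n u])
  finally show ?thesis by simp
qed

lemma mat_bounded:
  assumes A: "A \<in> carrier_mat n m"
  obtains K where "0 < K" "\<And>v. v \<in> carrier_vec m \<Longrightarrow> (A *\<^sub>v v) \<bullet> (A *\<^sub>v v) \<le> K * ((v :: real Matrix.vec) \<bullet> v)"
proof
  \<comment> \<open>The squared Frobenius norm, raised by 1 to be strictly positive.\<close>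
  define K where "K = (\<Sum>i<n. Matrix.row A i \<bullet> Matrix.row A i) + 1"
  show "0 < K"
    unfolding K_def by (intro add_nonneg_pos sum_nonneg vec_norm_sq_nonneg) auto
  fix v :: "real Matrix.vec" assume v: "v \<in> carrier_vec m"
  have *: "(Matrix.row A i \<bullet> v)\<^sup>2 \<le> (Matrix.row A i \<bullet> Matrix.row A i) * (v \<bullet> v)" if "i < n" for i
    unfolding scalar_prod_def using A v that Cauchy_Schwarz_ineq_sum[of "\<lambda>j. Matrix.row A i $ j" "\<lambda>j. v $ j" "{0..<m}"]
    by (simp add: power2_eq_square)
  have "(A *\<^sub>v v) \<bullet> (A *\<^sub>v v) = (\<Sum>i<n. (Matrix.row A i \<bullet> v)\<^sup>2)"
    using A by (simp add: scalar_prod_def[of "A *\<^sub>v v"] power2_eq_square atLeast0LessThan)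
  also have "\<dots> \<le> (\<Sum>i<n. (Matrix.row A i \<bullet> Matrix.row A i) * (v \<bullet> v))"
    by (intro sum_mono *) auto
  also have "\<dots> \<le> K * (v \<bullet> v)"
    using vec_norm_sq_nonneg[of v] by (simp add: K_def sum_distrib_right[symmetric] distrib_right)
  finally show "(A *\<^sub>v v) \<bullet> (A *\<^sub>v v) \<le> K * (v \<bullet> v)" .
qed

lemma symmetric_mat_scalar_prod:
  assumes "A \<in> carrier_mat n n" "A\<^sup>T = A" "u \<in> carrier_vec n" "v \<in> carrier_vec n"
  shows "u \<bullet> (A *\<^sub>v v) = (A *\<^sub>v u) \<bullet> (v :: real Matrix.vec)"
  using transpose_vec_mult_scalar[of A n n v u] assms by simp

text \<open>Testing positivity at \<open>v - t S v\<close> for a suitable \<open>t\<close> gives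
  \<open>t |S v|^2 <= v . S v\<close>, and the left inverse \<open>T\<close> bounds
  \<open>|v|\<close> by a multiple of \<open>|S v|\<close>. This takes the place of a spectral
  decomposition.\<close>

lemma psd_invertible_coercive:
  fixes S :: "real mat"
  assumes S: "S \<in> carrier_mat n n" and sym: "S\<^sup>T = S"
    and psd: "\<And>v. v \<in> carrier_vec n \<Longrightarrow> 0 \<le> v \<bullet> (S *\<^sub>v v)"
    and T: "T \<in> carrier_mat n n" and inv: "T * S = 1\<^sub>m n"
  obtains e where "0 < e" "\<And>v. v \<in> carrier_vec n \<Longrightarrow> e * (v \<bullet> v) \<le> v \<bullet> (S *\<^sub>v v)"
proof -
  obtain K where K: "0 < K" "\<And>v. v \<in> carrier_vec n \<Longrightarrow> (S *\<^sub>v v) \<bullet> (S *\<^sub>v v) \<le> K * (v \<bullet> v)"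
    using mat_bounded[OF S] by blast
  obtain L where L: "0 < L" "\<And>v. v \<in> carrier_vec n \<Longrightarrow> (T *\<^sub>v v) \<bullet> (T *\<^sub>v v) \<le> L * (v \<bullet> v)"
    using mat_bounded[OF T] by blast
  \<comment> \<open>Since \<open>u . w <= (1 + K) / 2 * |u|^2\<close>, this value makes the
    quadratic term \<open>t^2 (u . w)\<close> cancel at most half of
    \<open>2 t |u|^2\<close>.\<close>
  define t where "t = 2 / (1 + K)"
  have t: "t > 0" using K by (simp add: t_def)
  show thesis
  proof (rule that[of "t / L"])
    show "0 < t / L" using t L by simp
    fix v :: "real Matrix.vec" assume v: "v \<in> carrier_vec n"
    define u where "u = S *\<^sub>v v"
    have u: "u \<in> carrier_vec n" using S v by (simp add: u_def)
    define w where "w = S *\<^sub>v u"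
    have w: "w \<in> carrier_vec n" using S u by (simp add: w_def)
    have uw: "2 * (u \<bullet> w) \<le> (1 + K) * (u \<bullet> u)"
      using scalar_prod_le_half_sum[OF u w] K(2)[OF u] by (simp add: w_def algebra_simps)
    have vw: "v \<bullet> w = u \<bullet> u"
      using symmetric_mat_scalar_prod[OF S sym v u] by (simp add: u_def w_def)
    have "0 \<le> (v - t \<cdot>\<^sub>v u) \<bullet> (S *\<^sub>v (v - t \<cdot>\<^sub>v u))" using v u by (intro psd) simp
    also have "S *\<^sub>v (v - t \<cdot>\<^sub>v u) = u - t \<cdot>\<^sub>v w"
      using S v u by (simp add: mult_minus_distrib_mat_vec mult_mat_vec u_def w_def)
    also have "(v - t \<cdot>\<^sub>v u) \<bullet> (u - t \<cdot>\<^sub>v w) = v \<bullet> u - 2 * t * (u \<bullet> u) + t\<^sup>2 * (u \<bullet> w)"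
      using v u w vw
      by (simp add: minus_scalar_prod_distrib[of _ n] scalar_prod_minus_distrib[of _ n]
          power2_eq_square algebra_simps)
    also have "\<dots> \<le> v \<bullet> u - t * (u \<bullet> u)"
    proof -
      have "t * (t * (2 * (u \<bullet> w))) \<le> t * (t * ((1 + K) * (u \<bullet> u)))"
        using uw t by (intro mult_left_mono) auto
      also have "\<dots> = t * (t * (1 + K)) * (u \<bullet> u)" by (simp add: algebra_simps)
      also have "t * (1 + K) = 2" using K by (simp add: t_def field_simps)
      finally show ?thesis by (simp add: power2_eq_square algebra_simps)
    qed
    finally have 1: "t * (u \<bullet> u) \<le> v \<bullet> u" by simp
    have "T *\<^sub>v u = v"
      using S T v inv by (metis assoc_mult_mat_vec one_mult_mat_vec u_def)
    then have "v \<bullet> v \<le> L * (u \<bullet> u)" using L(2)[OF u] by simp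
    then have "t / L * (v \<bullet> v) \<le> t / L * (L * (u \<bullet> u))" using t L by (intro mult_left_mono) auto
    also have "\<dots> = t * (u \<bullet> u)" using L by simp
    finally show "t / L * (v \<bullet> v) \<le> v \<bullet> (S *\<^sub>v v)"
      using 1 by (simp add: u_def[symmetric])
  qed
qed

text \<open>The infimum \<open>m\<close> of the Rayleigh quotient is an eigenvalue: otherwise \<open>A - m I\<close> would be
  invertible and positive semidefinite, hence coercive, and \<open>m\<close> could be increased.\<close>

lemma min_eigenvalue_rayleigh:
  fixes A :: "real mat"
  assumes A: "A \<in> carrier_mat n n" and sym: "A\<^sup>T = A" and n: "0 < n"
  obtains m where "eigenvalue A m" "\<And>v. v \<in> carrier_vec n \<Longrightarrow> m * (v \<bullet> v) \<le> v \<bullet> (A *\<^sub>v v)"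
proof -
  define L where "L = {m. \<forall>v\<in>carrier_vec n. m * (v \<bullet> v) \<le> v \<bullet> (A *\<^sub>v v)}"
  obtain K where K: "0 < K" "\<And>v. v \<in> carrier_vec n \<Longrightarrow> (A *\<^sub>v v) \<bullet> (A *\<^sub>v v) \<le> K * (v \<bullet> v)"
    using mat_bounded[OF A] by blast
  \<comment> \<open>\<open>Sup L\<close> is meaningful only if \<open>L\<close> is nonempty;
    \<open>2 (-v) . (A v) <= |v|^2 + |A v|^2\<close> provides a member.\<close>
  have "- ((1 + K) / 2) \<in> L"
    unfolding L_def
  proof (safe)
    fix v :: "real Matrix.vec" assume v: "v \<in> carrier_vec n"
    have "2 * ((- v) \<bullet> (A *\<^sub>v v)) \<le> (- v) \<bullet> (- v) + (A *\<^sub>v v) \<bullet> (A *\<^sub>v v)"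
      using A v by (intro scalar_prod_le_half_sum[of _ n]) auto
    then have "- 2 * (v \<bullet> (A *\<^sub>v v)) \<le> v \<bullet> v + K * (v \<bullet> v)"
      using A v K(2)[OF v] by simp
    then show "- ((1 + K) / 2) * (v \<bullet> v) \<le> v \<bullet> (A *\<^sub>v v)" by (simp add: field_simps)
  qed
  then have ne: "L \<noteq> {}" by auto
  have unit: "unit_vec n 0 \<in> carrier_vec n" by simp
  have "unit_vec n 0 \<bullet> (unit_vec n 0 :: real Matrix.vec) = 1" using n by simp
  then have bdd: "bdd_above L"
    by (intro bdd_aboveI[of _ "unit_vec n 0 \<bullet> (A *\<^sub>v unit_vec n 0)"]) (use unit in \<open>fastforce simp: L_def dest!: bspec[of _ _ "unit_vec n 0"]\<close>)
  define m where "m = Sup L"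
  have m: "m * (v \<bullet> v) \<le> v \<bullet> (A *\<^sub>v v)" if v: "v \<in> carrier_vec n" for v
  proof (cases "v = 0\<^sub>v n")
    case True
    then show ?thesis using A by simp
  next
    case False
    then have pos: "0 < v \<bullet> v" using v by (intro vec_norm_sq_pos)
    have "m \<le> (v \<bullet> (A *\<^sub>v v)) / (v \<bullet> v)"
      unfolding m_def using ne v pos by (intro cSup_least) (auto simp: L_def field_simps)
    then show ?thesis using pos by (simp add: field_simps)
  qed
  have "eigenvalue A m"
  proof (rule ccontr)
    assume ne: "\<not> eigenvalue A m"
    define S where "S = A - m \<cdot>\<^sub>m 1\<^sub>m n"
    have S: "S \<in> carrier_mat n n" unfolding S_def by (intro minus_carrier_mat) simp
    have "char_matrix A m = S" using A by (auto simp: char_matrix_def S_def)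
    with ne have "Determinant.det S \<noteq> 0" using eigenvalue_det[OF A] by simp
    then have "S \<in> Units (ring_mat TYPE(real) n ())"
      using S by (intro det_non_zero_imp_unit)
    then obtain T where T: "T \<in> carrier_mat n n" "T * S = 1\<^sub>m n"
      by (auto simp: Units_def ring_mat_def)
    have Sv: "v \<bullet> (S *\<^sub>v v) = v \<bullet> (A *\<^sub>v v) - m * (v \<bullet> v)" if v: "v \<in> carrier_vec n" for v
    proof -
      have "(m \<cdot>\<^sub>m 1\<^sub>m n) *\<^sub>v v = m \<cdot>\<^sub>v v" using v by (intro eq_vecI) auto
      then have "S *\<^sub>v v = A *\<^sub>v v - m \<cdot>\<^sub>v v"
        using A v unfolding S_def by (simp add: minus_mult_distrib_mat_vec[of _ n n])
      then show ?thesis using A v by (simp add: scalar_prod_minus_distrib[of _ n])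
    qed
    have "S\<^sup>T = S"
    proof (rule eq_matI)
      fix i j assume ij: "i < dim_row S" "j < dim_col S"
      have "A $$ (j, i) = A $$ (i, j)" using ij A S by (metis carrier_matD index_transpose_mat(1) sym)
      then show "S\<^sup>T $$ (i, j) = S $$ (i, j)" using ij A S by (auto simp: S_def)
    qed (use S in auto)
    then obtain e where e: "0 < e" "\<And>v. v \<in> carrier_vec n \<Longrightarrow> e * (v \<bullet> v) \<le> v \<bullet> (S *\<^sub>v v)"
      using psd_invertible_coercive[OF S _ _ T] Sv m by (metis diff_ge_0_iff_ge)
    have "m + e \<in> L" unfolding L_def using e(2) Sv by (fastforce simp: algebra_simps)
    then have "m + e \<le> m" unfolding m_def using bdd by (intro cSup_upper)
    with e show False by simp
  qed
  with m that show thesis by blast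
qed

text \<open>\<open>Min\<close> and \<open>Max\<close> in \<open>cond_number\<close> say something
  only about finite sets. The eigenvalues are the roots of a monic, hence nonzero,
  polynomial.\<close>

lemma finite_eigenvalues:
  assumes "(A :: real mat) \<in> carrier_mat n n"
  shows "finite (Collect (eigenvalue A))"
proof -
  have "char_poly A \<noteq> 0" using degree_monic_char_poly[OF assms] by auto
  moreover have "Collect (eigenvalue A) = {x. poly (char_poly A) x = 0}"
    using eigenvalue_root_char_poly[OF assms] by auto
  ultimately show ?thesis using poly_roots_finite by simp
qed

lemma eigenvalue_rayleigh:
  assumes A: "A \<in> carrier_mat n n" and k: "eigenvalue A k"
  obtains v where "v \<in> carrier_vec n" "0 < v \<bullet> v" "v \<bullet> (A *\<^sub>v v) = k * ((v :: real Matrix.vec) \<bullet> v)"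
proof -
  obtain v where "v \<in> carrier_vec n" "v \<noteq> 0\<^sub>v n" "A *\<^sub>v v = k \<cdot>\<^sub>v v"
    using k A unfolding eigenvalue_def eigenvector_def by auto
  then show thesis using vec_norm_sq_pos[of v n] by (intro that[of v]) auto
qed

lemma Min_eigenvalue_le_rayleigh:
  assumes A: "(A :: real mat) \<in> carrier_mat n n" and sym: "A\<^sup>T = A" and n: "0 < n"
  shows "Collect (eigenvalue A) \<noteq> {}"
    and "v \<in> carrier_vec n \<Longrightarrow> Min (Collect (eigenvalue A)) * (v \<bullet> v) \<le> v \<bullet> (A *\<^sub>v v)"
proof -
  obtain m where m: "eigenvalue A m" "\<And>v. v \<in> carrier_vec n \<Longrightarrow> m * (v \<bullet> v) \<le> v \<bullet> (A *\<^sub>v v)"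
    using min_eigenvalue_rayleigh[OF assms] by blast
  then show "Collect (eigenvalue A) \<noteq> {}" by auto
  assume v: "v \<in> carrier_vec n"
  have "Min (Collect (eigenvalue A)) \<le> m"
    using m(1) finite_eigenvalues[OF A] by simp
  then show "Min (Collect (eigenvalue A)) * (v \<bullet> v) \<le> v \<bullet> (A *\<^sub>v v)"
    using m(2)[OF v] vec_norm_sq_nonneg[of v] by (meson mult_right_mono order_trans)
qed

text \<open>A lower bound for the form of \<open>- A\<close> is an upper bound for that of
  \<open>A\<close>, and the negative of the eigenvalue attaining it is an eigenvalue of
  \<open>A\<close>.\<close>

lemma rayleigh_le_Max_eigenvalue:
  assumes A: "(A :: real mat) \<in> carrier_mat n n" and sym: "A\<^sup>T = A" and n: "0 < n"
    and v: "v \<in> carrier_vec n"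
  shows "v \<bullet> (A *\<^sub>v v) \<le> Max (Collect (eigenvalue A)) * (v \<bullet> v)"
proof -
  have neg: "(- A) *\<^sub>v v = - (A *\<^sub>v v)" if "v \<in> carrier_vec n" for v
    using A that by (intro eq_vecI) (auto simp: uminus_scalar_prod)
  have "(- A)\<^sup>T = - A" using sym A by (simp add: transpose_uminus)
  then obtain m where m: "eigenvalue (- A) m"
      "\<And>v. v \<in> carrier_vec n \<Longrightarrow> m * (v \<bullet> v) \<le> v \<bullet> ((- A) *\<^sub>v v)"
    using min_eigenvalue_rayleigh[of "- A" n] A n by (metis uminus_carrier_iff_mat)
  obtain w where w: "w \<in> carrier_vec n" "w \<noteq> 0\<^sub>v n" "(- A) *\<^sub>v w = m \<cdot>\<^sub>v w"
    using m(1) A unfolding eigenvalue_def eigenvector_def by auto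
  have "- (A *\<^sub>v w) = m \<cdot>\<^sub>v w" using w neg by simp
  then have "A *\<^sub>v w = - (m \<cdot>\<^sub>v w)" by (metis uminus_uminus_vec)
  also have "\<dots> = (- m) \<cdot>\<^sub>v w" by (intro eq_vecI) auto
  finally have "A *\<^sub>v w = (- m) \<cdot>\<^sub>v w" .
  then have "eigenvalue A (- m)" unfolding eigenvalue_def eigenvector_def using w A by auto
  then have "- m \<le> Max (Collect (eigenvalue A))" using finite_eigenvalues[OF A] by simp
  then have "- m * (v \<bullet> v) \<le> Max (Collect (eigenvalue A)) * (v \<bullet> v)"
    using vec_norm_sq_nonneg[of v] by (rule mult_right_mono)
  moreover have "v \<bullet> (A *\<^sub>v v) \<le> - m * (v \<bullet> v)" using m(2)[OF v] neg[OF v] A v by simp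
  ultimately show ?thesis by simp
qed

section \<open>Least squares\<close>

context
  fixes B A :: "real mat" and n m :: nat
  assumes B: "B \<in> carrier_mat n m" and A_def: "A = B\<^sup>T * B"
begin

lemma gram_carrier: "A \<in> carrier_mat m m"
  using B by (simp add: A_def)

lemma gram_symmetric: "A\<^sup>T = A"
  using B by (simp add: A_def transpose_mult[of _ m n _ m])

lemma gram_form:
  assumes v: "v \<in> carrier_vec m"
  shows "v \<bullet> (A *\<^sub>v v) = (B *\<^sub>v v) \<bullet> (B *\<^sub>v v)"
proof -
  have "A *\<^sub>v v = B\<^sup>T *\<^sub>v (B *\<^sub>v v)"
    using B v by (simp add: A_def)
  moreover have "(B\<^sup>T *\<^sub>v (B *\<^sub>v v)) \<bullet> v = (B *\<^sub>v v) \<bullet> (B *\<^sub>v v)"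
    using B v by (intro transpose_vec_mult_scalar[of _ n m]) auto
  moreover have "v \<bullet> (B\<^sup>T *\<^sub>v (B *\<^sub>v v)) = (B\<^sup>T *\<^sub>v (B *\<^sub>v v)) \<bullet> v"
    using B v by (intro comm_scalar_prod[of _ m]) auto
  ultimately show ?thesis by simp
qed

text \<open>Eigenvalues are nonnegative because the quadratic form is \<open>|B v|^2\<close>;
  invertibility excludes 0.\<close>

lemma gram_eigenvalue_pos:
  assumes inv: "invertible_mat A" and k: "eigenvalue A k"
  shows "0 < k"
proof -
  obtain v where v: "v \<in> carrier_vec m" "0 < v \<bullet> v" "v \<bullet> (A *\<^sub>v v) = k * (v \<bullet> v)"
    using eigenvalue_rayleigh[OF gram_carrier k] by blast
  have "0 \<le> k * (v \<bullet> v)" using v gram_form vec_norm_sq_nonneg by metis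
  then have "0 \<le> k" using v(2) by (simp add: zero_le_mult_iff)
  moreover have "k \<noteq> 0"
  proof
    assume "k = 0"
    with k obtain w where w: "w \<in> carrier_vec m" "w \<noteq> 0\<^sub>v m" "A *\<^sub>v w = 0 \<cdot>\<^sub>v w"
      using gram_carrier unfolding eigenvalue_def eigenvector_def by auto
    obtain C where C: "inverts_mat A C" "inverts_mat C A"
      using inv unfolding invertible_mat_def by blast
    have CA: "C * A = 1\<^sub>m (dim_row C)" "A * C = 1\<^sub>m m"
      using C gram_carrier by (auto simp: inverts_mat_def)
    have dim: "C \<in> carrier_mat m m"
      using arg_cong[OF CA(1), of dim_col] arg_cong[OF CA(2), of dim_col] gram_carrier by auto
    have "w = C *\<^sub>v (A *\<^sub>v w)"
      using CA(1) dim gram_carrier w(1) by (simp flip: assoc_mult_mat_vec)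
    also have "A *\<^sub>v w = 0\<^sub>v m" using w by auto
    also have "C *\<^sub>v 0\<^sub>v m = 0\<^sub>v m" using dim by auto
    finally show False using w by simp
  qed
  ultimately show ?thesis by simp
qed

text \<open>By the normal equations \<open>B (c - d)\<close> is the orthogonal projection of the
  residual \<open>z - B d\<close> onto the range of \<open>B\<close>, so it is no longer than the
  residual. The vector \<open>d\<close> is any competitor; later it holds the coefficients of the
  approximating polynomial.\<close>

lemma least_squares_error:
  assumes inv: "invertible_mat A" and z: "z \<in> carrier_vec n" and d: "d \<in> carrier_vec m" and m: "0 < m"
  defines "c \<equiv> (the (mat_inverse A) * B\<^sup>T) *\<^sub>v z"
  shows "c \<in> carrier_vec m"
    and "Min (Collect (eigenvalue A)) * ((c - d) \<bullet> (c - d)) \<le> (z - B *\<^sub>v d) \<bullet> (z - B *\<^sub>v d)"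
proof -
  have A: "A \<in> carrier_mat m m" by (rule gram_carrier)
  obtain C where C: "inverts_mat A C" "inverts_mat C A"
    using inv unfolding invertible_mat_def by blast
  have CA: "C * A = 1\<^sub>m (dim_row C)" "A * C = 1\<^sub>m m"
    using C A by (auto simp: inverts_mat_def)
  have "C \<in> carrier_mat m m"
    using arg_cong[OF CA(1), of dim_col] arg_cong[OF CA(2), of dim_col] A by auto
  \<comment> \<open>\<open>mat_inverse\<close> returns an option; being a unit of the matrix ring is
    what excludes \<open>None\<close>.\<close>
  then have "A \<in> Units (ring_mat TYPE(real) m ())"
    using CA A unfolding Units_def by (auto simp: ring_mat_def intro!: bexI[of _ C])
  then obtain I where I: "mat_inverse A = Some I"
    using mat_inverse(1)[OF A, where b = "()"] by (cases "mat_inverse A") auto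
  have AI: "A * I = 1\<^sub>m m" "I \<in> carrier_mat m m" using mat_inverse(2)[OF A I] by auto
  have c: "c = I *\<^sub>v (B\<^sup>T *\<^sub>v z)" using I B AI z by (simp add: c_def)
  show cc: "c \<in> carrier_vec m" using c AI B z by auto
  define u where "u = c - d"
  define r where "r = z - B *\<^sub>v d"
  have u: "u \<in> carrier_vec m" and r: "r \<in> carrier_vec n" using cc d z B by (auto simp: u_def r_def)
  have "A *\<^sub>v c = B\<^sup>T *\<^sub>v z"
    using AI A B z by (simp add: c flip: assoc_mult_mat_vec[of A m m I m])
  moreover have "A *\<^sub>v d = B\<^sup>T *\<^sub>v (B *\<^sub>v d)" using B d by (simp add: A_def)
  ultimately have Au: "A *\<^sub>v u = B\<^sup>T *\<^sub>v r"
    using A B cc d z by (simp add: u_def r_def mult_minus_distrib_mat_vec[of _ _ m] mult_minus_distrib_mat_vec[of _ _ n])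
  have Bu: "B *\<^sub>v u \<in> carrier_vec n" using B u by simp
  have "(B *\<^sub>v u) \<bullet> (B *\<^sub>v u) = u \<bullet> (A *\<^sub>v u)" using gram_form[OF u] by simp
  also have "\<dots> = (B\<^sup>T *\<^sub>v r) \<bullet> u" unfolding Au using u r B by (intro comm_scalar_prod[of _ m]) auto
  also have "\<dots> = r \<bullet> (B *\<^sub>v u)" using B u r by (intro transpose_vec_mult_scalar[of _ n m])
  finally have "(B *\<^sub>v u) \<bullet> (B *\<^sub>v u) \<le> r \<bullet> r"
    using scalar_prod_le_half_sum[OF r Bu] by simp
  moreover have "Min (Collect (eigenvalue A)) * (u \<bullet> u) \<le> u \<bullet> (A *\<^sub>v u)"
    by (rule Min_eigenvalue_le_rayleigh(2)[OF A gram_symmetric m u])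
  ultimately show "Min (Collect (eigenvalue A)) * ((c - d) \<bullet> (c - d)) \<le> (z - B *\<^sub>v d) \<bullet> (z - B *\<^sub>v d)"
    using gram_form[OF u] by (simp add: u_def r_def)
qed

lemma gram_first_entry_le_Max_eigenvalue:
  assumes m: "0 < m"
  shows "A $$ (0, 0) \<le> Max (Collect (eigenvalue A))"
proof -
  have "unit_vec m 0 \<bullet> (A *\<^sub>v unit_vec m 0) = A $$ (0, 0)"
    using gram_carrier m by simp
  moreover have "unit_vec m 0 \<bullet> (unit_vec m 0 :: real Matrix.vec) = 1" using m by simp
  ultimately show ?thesis
    using rayleigh_le_Max_eigenvalue[OF gram_carrier gram_symmetric m, of "unit_vec m 0"] by simp
qed

end

section \<open>Polynomial interpolation at the Chebyshev nodes\<close>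

text \<open>Points are added in increasing order, and each new one yields a zero of
  \<open>f'\<close> between the previous maximum and itself. The bounds by \<open>Min Z\<close> and
  \<open>Max Z\<close> are carried along because they keep this zero apart from the earlier
  ones.\<close>

lemma rolle_many_zeros:
  fixes f f' :: "real \<Rightarrow> real"
  assumes "finite Z" "card Z = Suc n" "\<And>z. z \<in> Z \<Longrightarrow> f z = 0"
    and "\<And>x. (f has_real_derivative f' x) (at x)"
  shows "\<exists>W. finite W \<and> card W = n \<and> (\<forall>w\<in>W. f' w = 0 \<and> Min Z < w \<and> w < Max Z)"
  using assms(1-3)
proof (induction Z arbitrary: n rule: finite_linorder_max_induct)
  case empty
  then show ?case by simp
next
  case (insert b A)
  show ?case
  proof (cases "A = {}")
    case True
    then show ?thesis using insert.prems by (intro exI[of _ "{}"]) auto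
  next
    case False
    have "b \<notin> A" using insert.hyps by auto
    then have cA: "card A = n" using insert.prems insert.hyps by simp
    with False insert.hyps obtain k where k: "n = Suc k" by (cases n) auto
    obtain W where W: "finite W" "card W = k" "\<forall>w\<in>W. f' w = 0 \<and> Min A < w \<and> w < Max A"
      using insert.IH[of k] cA k insert.prems by auto
    have mA: "Max A \<in> A" "Max A < b" using False insert.hyps by auto
    have "\<exists>z. Max A < z \<and> z < b \<and> f' z = 0"
    proof (rule Rolle_deriv[where f = f and f' = "\<lambda>x v. f' x * v", THEN exE])
      show "Max A < b" by fact
      show "f (Max A) = f b" using insert.prems mA by auto
      show "continuous_on {Max A..b} f"
        using assms(4) by (intro continuous_at_imp_continuous_on) (auto intro: DERIV_isCont)
      show "(f has_derivative (\<lambda>v. f' x * v)) (at x)" for x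
        using assms(4)[of x] by (simp add: has_field_derivative_def)
      fix z assume z: "Max A < z \<and> z < b \<and> (\<lambda>v. f' z * v) = (\<lambda>v. 0)"
      then have "f' z = 0" by (metis mult.right_neutral)
      with z show "\<exists>z. Max A < z \<and> z < b \<and> f' z = 0" by blast
    qed
    then obtain z where z: "Max A < z" "z < b" "f' z = 0" by blast
    have mins: "Min (insert b A) = Min A" "Max (insert b A) = b"
      using False insert.hyps mA Min_le[of A "Max A"] by auto
    have "Min A \<le> Max A" using False insert.hyps by simp
    then show ?thesis
      using W z mA k mins by (intro exI[of _ "insert z W"]) (force simp: card_insert_if)
  qed
qed

lemma rolle_higher:
  fixes f :: "nat \<Rightarrow> real \<Rightarrow> real"
  assumes "finite Z" "card Z = Suc n" "\<And>z. z \<in> Z \<Longrightarrow> f 0 z = 0"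
    and "\<And>k x. (f k has_real_derivative f (Suc k) x) (at x)"
  shows "\<exists>z. f n z = 0"
  using assms
proof (induction n arbitrary: Z f)
  case 0
  then have "Z \<noteq> {}" by auto
  with 0 show ?case by auto
next
  case (Suc n)
  obtain W where "finite W" "card W = Suc n" "\<forall>w\<in>W. f (Suc 0) w = 0"
    using rolle_many_zeros[OF Suc.prems(1-4)] by blast
  then show ?case using Suc.IH[of W "\<lambda>k. f (Suc k)"] Suc.prems(4) by auto
qed

text \<open>The remainder term comes from applying Rolle's theorem repeatedly to
  \<open>f - p - \<lambda> w\<close>, with \<open>\<lambda>\<close> chosen such that it also vanishes at \<open>x\<close>.\<close>

lemma interpolation_error:
  fixes f :: "nat \<Rightarrow> real \<Rightarrow> real" and p w :: "real poly"
  assumes Z: "finite Z" "card Z = n"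
    and deg: "Polynomial.degree p < n" "Polynomial.degree w = n" "lead_coeff w = 1"
    and zeros: "\<And>z. z \<in> Z \<Longrightarrow> f 0 z = poly p z" "\<And>z. z \<in> Z \<Longrightarrow> poly w z = 0"
    and der: "\<And>k x. (f k has_real_derivative f (Suc k) x) (at x)"
    and bound: "\<And>x. \<bar>f n x\<bar> \<le> K"
  shows "\<bar>f 0 x - poly p x\<bar> \<le> K / fact n * \<bar>poly w x\<bar>"
proof (cases "poly w x = 0")
  case True
  \<comment> \<open>A zero of \<open>w\<close> outside \<open>Z\<close> would be one root too many
    for a polynomial of degree \<open>n\<close>.\<close>
  have "x \<in> Z"
  proof (rule ccontr)
    assume "x \<notin> Z"
    have "w \<noteq> 0" using deg by auto
    have "insert x Z \<subseteq> {x. poly w x = 0}" using zeros True by auto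
    then have "card (insert x Z) \<le> Polynomial.degree w"
      using order_trans[OF card_mono[OF poly_roots_finite] card_poly_roots_bound] \<open>w \<noteq> 0\<close> by blast
    then show False using \<open>x \<notin> Z\<close> Z deg by simp
  qed
  then show ?thesis using zeros True by simp
next
  case False
  define l where "l = (f 0 x - poly p x) / poly w x"
  define F where "F k t = f k t - poly ((pderiv ^^ k) (p + Polynomial.smult l w)) t" for k t
  have "\<exists>z. F n z = 0"
  proof (rule rolle_higher[of "insert x Z"])
    have "x \<notin> Z" using zeros(2) False by blast
    then show "card (insert x Z) = Suc n" using Z by simp
    show "F 0 z = 0" if "z \<in> insert x Z" for z
      using that zeros(1)[of z] zeros(2)[of z] False by (cases "z = x") (simp_all add: F_def l_def)
    show "(F k has_real_derivative F (Suc k) t) (at t)" for k t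
      unfolding F_def by (auto intro!: derivative_eq_intros der poly_DERIV)
  qed (use Z in auto)
  then obtain z where z: "F n z = 0" by blast
  \<comment> \<open>\<open>n\<close> derivatives annihilate \<open>p\<close> and reduce the monic
    \<open>w\<close> to \<open>n!\<close>.\<close>
  have "(pderiv ^^ n) (p + Polynomial.smult l w) = [:l * fact n:]"
  proof (rule poly_eqI)
    fix i
    have "coeff p (i + n) = 0" using deg by (intro coeff_eq_0) auto
    moreover have "coeff w (i + n) = (if i = 0 then 1 else 0)"
      using deg by (auto intro: coeff_eq_0)
    ultimately show "coeff ((pderiv ^^ n) (p + Polynomial.smult l w)) i = coeff [:l * fact n:] i"
      by (auto simp: coeff_higher_pderiv pochhammer_fact[symmetric] coeff_pCons split: nat.split)
  qed
  with z have "l * fact n = f n z" by (simp add: F_def)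
  then have "\<bar>l\<bar> * fact n \<le> K" using bound[of z] by (metis abs_mult abs_of_nonneg fact_ge_zero)
  then have "\<bar>l\<bar> \<le> K / fact n" by (simp add: field_simps)
  then have "\<bar>l\<bar> * \<bar>poly w x\<bar> \<le> K / fact n * \<bar>poly w x\<bar>" by (intro mult_right_mono) auto
  moreover have "f 0 x - poly p x = l * poly w x" using False by (simp add: l_def)
  ultimately show ?thesis by (simp add: abs_mult)
qed

section \<open>Chebyshev polynomials, their nodes and the Lagrange basis\<close>

fun chebyshev :: "nat \<Rightarrow> real poly" where
  "chebyshev 0 = 1"
| "chebyshev (Suc 0) = [:0, 1:]"
| "chebyshev (Suc (Suc n)) = [:0, 2:] * chebyshev (Suc n) - chebyshev n"

lemma poly_chebyshev_cos: "poly (chebyshev n) (cos t) = cos (real n * t)"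
proof (induction n rule: chebyshev.induct)
  case (3 n)
  have "cos ((real n + 2) * t) + cos (real n * t) = 2 * cos t * cos ((real n + 1) * t)"
    using cos_add[of "(real n + 1) * t" t] cos_diff[of "(real n + 1) * t" t]
    by (simp add: algebra_simps)
  then show ?case using 3 by (simp add: algebra_simps)
qed auto

text \<open>The claims are coupled: the degree is read off from a nonvanishing top coefficient. That
  coefficient is stated one index ahead so that its value is \<open>2 ^ n\<close> without a
  subtraction.\<close>

lemma chebyshev_degree:
  "Polynomial.degree (chebyshev n) = n \<and> coeff (chebyshev (Suc n)) (Suc n) = 2 ^ n"
proof (induction n rule: chebyshev.induct)
  case (3 n)
  have *: "coeff (chebyshev (Suc (Suc n))) k = 0" if "k > Suc (Suc n)" for k
    using 3 that by (auto simp: coeff_pCons coeff_eq_0 split: nat.split)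
  have c: "coeff (chebyshev (Suc (Suc n))) (Suc (Suc n)) = 2 ^ Suc n"
    using 3 by (simp add: coeff_eq_0)
  have d: "Polynomial.degree (chebyshev (Suc (Suc n))) = Suc (Suc n)"
    using * c by (metis degree_le leI le_antisym le_degree power_not_zero zero_neq_numeral)
  then show ?case using c by (simp add: coeff_eq_0 del: chebyshev.simps(3)) (simp add: coeff_eq_0 3)
qed auto

definition chebyshev_node :: "nat \<Rightarrow> nat \<Rightarrow> real" where
  "chebyshev_node n j = cos ((2 * real j + 1) * pi / (2 * real n))"

text \<open>The node angles lie in \<open>[0, pi]\<close>, where the cosine is injective.\<close>

lemma chebyshev_node_inj: "inj_on (chebyshev_node n) {..<n}"
proof (rule inj_onI)
  fix i j assume ij: "i \<in> {..<n}" "j \<in> {..<n}" "chebyshev_node n i = chebyshev_node n j"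
  have le: "(2 * real k + 1) * pi / (2 * real n) \<le> pi" if "k < n" for k
  proof -
    have "(2 * real k + 1) * pi \<le> (2 * real n) * pi" using that by (intro mult_right_mono) auto
    then show ?thesis using that by (simp add: field_simps)
  qed
  have "(2 * real i + 1) * pi / (2 * real n) = (2 * real j + 1) * pi / (2 * real n)"
  proof (rule cos_inj_pi)
    show "cos ((2 * real i + 1) * pi / (2 * real n)) = cos ((2 * real j + 1) * pi / (2 * real n))"
      using ij(3) unfolding chebyshev_node_def .
    show "(2 * real i + 1) * pi / (2 * real n) \<le> pi" "(2 * real j + 1) * pi / (2 * real n) \<le> pi"
      using ij(1,2) by (simp_all only: le lessThan_iff)
  qed simp_all
  moreover have "real n > 0" using ij(1) by (cases n) auto
  ultimately show "i = j" by (simp add: divide_simps)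
qed

lemma chebyshev_node_zero: 
  assumes "0 < n" shows "poly (chebyshev n) (chebyshev_node n j) = 0"
proof -
  have "real n * ((2 * real j + 1) * pi / (2 * real n)) = pi / 2 + real j * pi"
    using assms by (simp add: field_simps)
  then show ?thesis
    unfolding chebyshev_node_def poly_chebyshev_cos by (simp add: cos_add)
qed

definition lagrange :: "nat \<Rightarrow> nat \<Rightarrow> real poly" where
  "lagrange n j = Polynomial.smult (1 / (\<Prod>i\<in>{..<n} - {j}. chebyshev_node n j - chebyshev_node n i))
     (\<Prod>i\<in>{..<n} - {j}. [:- chebyshev_node n i, 1:])"

lemma degree_lagrange:
  assumes "j < n" shows "Polynomial.degree (lagrange n j) < n"
proof -
  have "Polynomial.degree (lagrange n j) \<le> (\<Sum>i\<in>{..<n} - {j}. Polynomial.degree [:- chebyshev_node n i, 1:])"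
    unfolding lagrange_def 
    by (rule order_trans[OF degree_smult_le]) (use degree_prod_sum_le[of "{..<n} - {j}" "\<lambda>i. [:- chebyshev_node n i, 1:]"] in simp)
  also have "\<dots> = n - 1" using assms by simp
  finally show ?thesis using assms by simp
qed

lemma poly_lagrange:
  assumes "i < n" "j < n"
  shows "poly (lagrange n j) (chebyshev_node n i) = (if i = j then 1 else 0)"
proof (cases "i = j")
  case True
  have "chebyshev_node n j \<noteq> chebyshev_node n k" if "k \<in> {..<n} - {j}" for k
    using that assms chebyshev_node_inj[of n] by (auto dest: inj_onD)
  then show ?thesis using True by (simp add: lagrange_def poly_prod)
next
  case False
  then show ?thesis using assms by (auto simp: lagrange_def poly_prod intro!: prod_zero bexI[of _ i])
qed

text \<open>The Lagrange form is linear in the values of \<open>g\<close>, which is what lets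
  interpolation pass under the Fourier integral.\<close>

definition interpolant :: "nat \<Rightarrow> (real \<Rightarrow> real) \<Rightarrow> real poly" where
  "interpolant n g = (\<Sum>j<n. Polynomial.smult (g (chebyshev_node n j)) (lagrange n j))"

lemma degree_interpolant:
  assumes "0 < n" shows "Polynomial.degree (interpolant n g) < n"
  unfolding interpolant_def using assms
  by (intro degree_sum_less) (auto intro!: degree_lagrange le_less_trans[OF degree_smult_le])

lemma chebyshev_interpolation_error:
  fixes f :: "nat \<Rightarrow> real \<Rightarrow> real"
  assumes n: "0 < n" and x: "\<bar>x\<bar> \<le> 1"
    and der: "\<And>k x. (f k has_real_derivative f (Suc k) x) (at x)"
    and bound: "\<And>x. \<bar>f n x\<bar> \<le> K"
  shows "\<bar>f 0 x - poly (interpolant n (f 0)) x\<bar> \<le> K / (fact n * 2 ^ (n - 1))"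
proof -
  \<comment> \<open>The monic polynomial vanishing at the nodes. Dividing by the leading coefficient
    \<open>2 ^ (n - 1)\<close> of a polynomial bounded by 1 on \<open>[-1, 1]\<close> is the gain
    from the Chebyshev choice.\<close>
  define w where "w = Polynomial.smult (1 / 2 ^ (n - 1)) (chebyshev n)"
  have lc: "coeff (chebyshev n) n = 2 ^ (n - 1)" using chebyshev_degree[of "n - 1"] n by simp
  have dw: "Polynomial.degree w = n" using chebyshev_degree[of n] by (simp add: w_def)
  have Z: "card (chebyshev_node n ` {..<n}) = n" by (simp add: card_image chebyshev_node_inj)
  have "\<bar>f 0 x - poly (interpolant n (f 0)) x\<bar> \<le> K / fact n * \<bar>poly w x\<bar>"
  proof (rule interpolation_error[where Z = "chebyshev_node n ` {..<n}", OF _ Z])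
    show "lead_coeff w = 1" unfolding dw using lc by (simp add: w_def)
    show "Polynomial.degree (interpolant n (f 0)) < n" by (rule degree_interpolant[OF n])
    fix z assume "z \<in> chebyshev_node n ` {..<n}"
    then obtain i where i: "i < n" "z = chebyshev_node n i" by auto
    show "f 0 z = poly (interpolant n (f 0)) z"
      using i by (simp add: interpolant_def poly_sum poly_lagrange if_distrib cong: if_cong)
    show "poly w z = 0" using i n by (simp add: w_def chebyshev_node_zero)
  qed (use dw der bound in auto)
  also have "\<bar>poly w x\<bar> \<le> 1 / 2 ^ (n - 1)"
  proof -
    have "\<bar>poly (chebyshev n) x\<bar> \<le> 1"
      using poly_chebyshev_cos[of n "arccos x"] x by (simp add: abs_le_iff)
    then show ?thesis by (simp add: w_def abs_mult field_simps)
  qed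
  then have "K / fact n * \<bar>poly w x\<bar> \<le> K / fact n * (1 / 2 ^ (n - 1))"
    using bound[of 0] by (intro mult_left_mono) auto
  finally show ?thesis by simp
qed

section \<open>Fourier inversion for bandlimited functions\<close>

text \<open>A rescaling of the characteristic function of the standard normal law.\<close>

lemma fourier_normal_density:
  assumes "0 < \<tau>"
  shows "(\<integral>\<xi>. normal_density 0 \<tau> \<xi> *\<^sub>R iexp (a * \<xi>) \<partial>lborel) = complex_of_real (exp (- (\<tau> * a)\<^sup>2 / 2))"
proof -
  have "complex_of_real (exp (- (\<tau> * a)\<^sup>2 / 2)) = char std_normal_distribution (\<tau> * a)"
    by (simp add: char_std_normal_distribution)
  also have "\<dots> = (\<integral>x. std_normal_density x *\<^sub>R iexp (\<tau> * a * x) \<partial>lborel)"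
    unfolding char_def by (subst integral_density) auto
  also have "\<dots> = (\<integral>x. \<tau> *\<^sub>R (normal_density 0 \<tau> (0 + \<tau> * x) *\<^sub>R iexp (a * (0 + \<tau> * x))) \<partial>lborel)"
    using assms by (intro Bochner_Integration.integral_cong)
      (auto simp: normal_density_def power_mult_distrib real_sqrt_mult field_simps)
  also have "\<dots> = \<tau> *\<^sub>R (\<integral>x. normal_density 0 \<tau> (0 + \<tau> * x) *\<^sub>R iexp (a * (0 + \<tau> * x)) \<partial>lborel)"
    by (rule integral_scaleR_right)
  also have "\<dots> = (\<integral>\<xi>. normal_density 0 \<tau> \<xi> *\<^sub>R iexp (a * \<xi>) \<partial>lborel)"
    using assms by (subst (2) lborel_integral_real_affine[where c = \<tau> and t = 0]) auto
  finally show ?thesis by simp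
qed

lemma gaussian_eq_normal_density:
  assumes "0 < s"
  shows "exp (- (s * \<xi>)\<^sup>2 / 2) = sqrt (2 * pi) / s * normal_density 0 (1 / s) \<xi>"
  using assms by (simp add: normal_density_def power_mult_distrib real_sqrt_divide field_simps)

lemma integrable_gaussian:
  fixes s :: real assumes "0 < s"
  shows "integrable lborel (\<lambda>\<xi>. exp (- (s * \<xi>)\<^sup>2 / 2))"
  unfolding gaussian_eq_normal_density[OF assms] using assms
  by (intro integrable_mult_right integrable_normal_density) simp

text \<open>Damping frequencies by a Gaussian of width \<open>1 / s\<close> corresponds to averaging
  with a normal kernel of width \<open>s\<close> around \<open>x\<close>; this is the kernel of the
  approximate identity below.\<close>

lemma fourier_gaussian:
  assumes "0 < s"
  shows "(\<integral>\<xi>. exp (- (s * \<xi>)\<^sup>2 / 2) *\<^sub>R iexp ((x - y) * \<xi>) \<partial>lborel) =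
     complex_of_real (2 * pi * normal_density x s y)"
proof -
  have "(\<integral>\<xi>. exp (- (s * \<xi>)\<^sup>2 / 2) *\<^sub>R iexp ((x - y) * \<xi>) \<partial>lborel) =
      (\<integral>\<xi>. (sqrt (2 * pi) / s) *\<^sub>R (normal_density 0 (1 / s) \<xi> *\<^sub>R iexp ((x - y) * \<xi>)) \<partial>lborel)"
    unfolding gaussian_eq_normal_density[OF assms] by simp
  also have "\<dots> = (sqrt (2 * pi) / s) *\<^sub>R (\<integral>\<xi>. normal_density 0 (1 / s) \<xi> *\<^sub>R iexp ((x - y) * \<xi>) \<partial>lborel)"
    by (rule integral_scaleR_right)
  also have "\<dots> = (sqrt (2 * pi) / s) *\<^sub>R complex_of_real (exp (- (1 / s * (x - y))\<^sup>2 / 2))"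
    using assms by (subst fourier_normal_density) auto
  also have "\<dots> = complex_of_real (2 * pi * normal_density x s y)"
  proof -
    have "2 * pi = sqrt (2 * pi) * sqrt (2 * pi)" by simp
    then have "sqrt (2 * pi) / s = 2 * pi / sqrt (2 * pi * s\<^sup>2)"
      using assms by (simp add: real_sqrt_mult field_simps)
    then show ?thesis
      using assms by (simp add: normal_density_def scaleR_conv_of_real power_divide power2_commute field_simps flip: of_real_mult)
  qed
  finally show ?thesis .
qed

text \<open>\<open>L\<^sup>2\<close> functions times bounded integrable functions are integrable since
  \<open>2 |g h| \<le> g\<^sup>2 + h\<^sup>2\<close>.\<close>

lemma integrable_square_times_bounded:
  fixes g :: "real \<Rightarrow> 'a::{banach, second_countable_topology, real_normed_field}" and h :: "real \<Rightarrow> 'a"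
  assumes g: "square_integrable g" and h: "integrable lborel h" and K: "\<And>x. norm (h x) \<le> K"
  shows "integrable lborel (\<lambda>x. g x * h x)"
proof (rule Bochner_Integration.integrable_bound)
  show "integrable lborel (\<lambda>x. (norm (g x))\<^sup>2 + K * norm (h x))"
    using g h by (auto simp: square_integrable_def)
  show "(\<lambda>x. g x * h x) \<in> borel_measurable lborel"
    using g h by (auto simp: square_integrable_def)
  show "AE x in lborel. norm (g x * h x) \<le> norm ((norm (g x))\<^sup>2 + K * norm (h x))"
  proof (rule AE_I2)
    fix x
    have "0 \<le> (norm (g x) - norm (h x))\<^sup>2" by simp
    then have 1: "2 * (norm (g x) * norm (h x)) \<le> (norm (g x))\<^sup>2 + (norm (h x))\<^sup>2"
      by (simp add: power2_diff)
    have 2: "(norm (h x))\<^sup>2 \<le> K * norm (h x)"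
      using mult_right_mono[OF K[of x], of "norm (h x)"] by (simp add: power2_eq_square)
    have 3: "0 \<le> norm (g x) * norm (h x)" by simp
    have "norm (g x * h x) \<le> (norm (g x))\<^sup>2 + K * norm (h x)"
      unfolding norm_mult using 1 2 3 by linarith
    then show "norm (g x * h x) \<le> norm ((norm (g x))\<^sup>2 + K * norm (h x))" by simp
  qed
qed

lemma normal_density_le:
  assumes "0 < s" shows "normal_density x s y \<le> 1 / s"
proof -
  have "1 \<le> sqrt (2 * pi)" using pi_gt3 by (simp add: real_le_rsqrt)
  moreover have "exp (- (y - x)\<^sup>2 / (2 * s\<^sup>2)) \<le> 1" using assms by simp
  ultimately have "exp (- (y - x)\<^sup>2 / (2 * s\<^sup>2)) / (sqrt (2 * pi) * s) \<le> 1 / (1 * s)"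
    using assms by (intro frac_le mult_right_mono) auto
  then show ?thesis
    using assms by (simp add: normal_density_def real_sqrt_mult)
qed

text \<open>Fubini's theorem: the truncation in \<open>y\<close> and the Gaussian in
  \<open>\<xi>\<close> together make the double integrand absolutely integrable.\<close>

lemma truncated_fourier_gaussian:
  fixes g :: "real \<Rightarrow> real"
  assumes g: "continuous_on UNIV g" and s: "0 < s"
  shows "(\<integral>\<xi>. (LINT y:{-R..R}|lborel. exp (- (\<i> * complex_of_real (y * \<xi>))) * complex_of_real (g y))
          * (exp (- (s * \<xi>)\<^sup>2 / 2) *\<^sub>R iexp (x * \<xi>)) \<partial>lborel)
      = (LINT y:{-R..R}|lborel. complex_of_real (g y * (2 * pi * normal_density x s y)))"
proof -
  define H where "H \<xi> y = indicator {-R..R} y *\<^sub>R (complex_of_real (g y) *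
     (exp (- (s * \<xi>)\<^sup>2 / 2) *\<^sub>R iexp ((x - y) * \<xi>)))" for \<xi> y
  have gm[measurable]: "g \<in> borel_measurable borel"
    using g by (rule borel_measurable_continuous_onI)
  have gi: "integrable lborel (\<lambda>y. indicator {-R..R} y *\<^sub>R \<bar>g y\<bar>)"
    using g by (intro borel_integrable_compact) (auto intro!: continuous_intros intro: continuous_on_subset)
  have Hm[measurable]: "case_prod H \<in> borel_measurable (lborel \<Otimes>\<^sub>M lborel)"
    unfolding H_def by measurable
  have norm_H: "norm (H \<xi> y) = exp (- (s * \<xi>)\<^sup>2 / 2) * (indicator {-R..R} y *\<^sub>R \<bar>g y\<bar>)" for \<xi> y
    by (simp add: H_def norm_mult)
  have "integrable (lborel \<Otimes>\<^sub>M lborel) (case_prod H)"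
  proof (rule lborel_pair.Fubini_integrable)
    show "integrable lborel (\<lambda>\<xi>. \<integral>y. norm (case_prod H (\<xi>, y)) \<partial>lborel)"
      using gi integrable_gaussian[OF s] by (simp add: norm_H)
    have "integrable lborel (\<lambda>y. H \<xi> y)" for \<xi>
      using gi by (subst integrable_norm_iff[symmetric]) (auto simp: norm_H)
    then show "AE \<xi> in lborel. integrable lborel (\<lambda>y. case_prod H (\<xi>, y))" by simp
  qed simp
  from lborel_pair.Fubini_integral[OF this]
  have "(\<integral>y. (\<integral>\<xi>. H \<xi> y \<partial>lborel) \<partial>lborel) = (\<integral>\<xi>. (\<integral>y. H \<xi> y \<partial>lborel) \<partial>lborel)" .
  moreover have "(\<integral>\<xi>. H \<xi> y \<partial>lborel) = indicator {-R..R} y *\<^sub>R complex_of_real (g y * (2 * pi * normal_density x s y))" for y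
    unfolding H_def by (simp only: integral_scaleR_right integral_mult_right_zero fourier_gaussian[OF s]) simp
  moreover have "(\<integral>y. H \<xi> y \<partial>lborel) = (LINT y:{-R..R}|lborel. exp (- (\<i> * complex_of_real (y * \<xi>))) * complex_of_real (g y))
          * (exp (- (s * \<xi>)\<^sup>2 / 2) *\<^sub>R iexp (x * \<xi>))" for \<xi>
    unfolding H_def set_lebesgue_integral_def integral_mult_left_zero[symmetric]
    by (intro Bochner_Integration.integral_cong refl)
      (simp add: algebra_simps exp_diff exp_minus field_simps scaleR_conv_of_real flip: of_real_mult)
  ultimately show ?thesis by (simp add: set_lebesgue_integral_def)
qed

text \<open>Let \<open>R\<close> tend to infinity in the truncated identity. On the frequency side,
  L2 convergence becomes convergence of the integrals against \<open>h\<close> by the Cauchy-Schwarz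
  inequality; on the other side the limit is dominated.\<close>

lemma fourier_transform_gaussian:
  fixes g :: "real \<Rightarrow> real"
  assumes g: "continuous_on UNIV g" and F: "is_fourier_transform g F" and s: "0 < s"
  shows "(\<integral>\<xi>. F \<xi> * (exp (- (s * \<xi>)\<^sup>2 / 2) *\<^sub>R iexp (x * \<xi>)) \<partial>lborel)
      = complex_of_real (2 * pi * (\<integral>y. g y * normal_density x s y \<partial>lborel))"
proof -
  define h where "h \<xi> = exp (- (s * \<xi>)\<^sup>2 / 2) *\<^sub>R iexp (x * \<xi>)" for \<xi>
  define T where "T R \<xi> = (LINT y:{-R..R}|lborel. exp (- (\<i> * complex_of_real (y * \<xi>))) * complex_of_real (g y))" for R \<xi>
  have gm[measurable]: "g \<in> borel_measurable borel"
    using g by (rule borel_measurable_continuous_onI)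
  have g2: "square_integrable g" and F2: "square_integrable F"
    and lim: "((\<lambda>R. \<integral>\<^sup>+ \<xi>. ennreal ((cmod (T R \<xi> - F \<xi>))\<^sup>2) \<partial>lborel) \<longlongrightarrow> 0) at_top"
    using F unfolding is_fourier_transform_def T_def by auto
  have Fm[measurable]: "F \<in> borel_measurable borel" using F2 by (simp add: square_integrable_def)
  have hm[measurable]: "h \<in> borel_measurable borel" unfolding h_def by measurable
  have hn: "norm (h \<xi>) = exp (- (s * \<xi>)\<^sup>2 / 2)" for \<xi> by (simp add: h_def)
  have h1: "norm (h \<xi>) \<le> 1" for \<xi> by (simp add: hn)
  have hi: "integrable lborel h"
    using integrable_gaussian[OF s] by (subst integrable_norm_iff[symmetric]) (auto simp: hn)
  have Fh: "integrable lborel (\<lambda>\<xi>. F \<xi> * h \<xi>)"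
    by (rule integrable_square_times_bounded[OF F2 hi h1])
  have Tm[measurable]: "T R \<in> borel_measurable borel" for R
    unfolding T_def set_lebesgue_integral_def by measurable
  have gi: "integrable lborel (\<lambda>y. indicator {-R..R} y *\<^sub>R \<bar>g y\<bar>)" for R
    using g by (intro borel_integrable_compact) (auto intro!: continuous_intros intro: continuous_on_subset)
  have Tb: "norm (T R \<xi>) \<le> (\<integral>y. indicator {-R..R} y *\<^sub>R \<bar>g y\<bar> \<partial>lborel)" for R \<xi>
    unfolding T_def set_lebesgue_integral_def
    by (rule order_trans[OF integral_norm_bound]) (simp add: norm_mult)
  have Th: "integrable lborel (\<lambda>\<xi>. T R \<xi> * h \<xi>)" for R
  proof (rule Bochner_Integration.integrable_bound)
    show "integrable lborel (\<lambda>\<xi>. (\<integral>y. indicator {-R..R} y *\<^sub>R \<bar>g y\<bar> \<partial>lborel) * norm (h \<xi>))"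
      using hi by (intro integrable_mult_right integrable_norm)
    show "AE \<xi> in lborel. norm (T R \<xi> * h \<xi>) \<le> norm ((\<integral>y. indicator {-R..R} y *\<^sub>R \<bar>g y\<bar> \<partial>lborel) * norm (h \<xi>))"
      using Tb by (intro AE_I2) (auto simp: norm_mult intro!: mult_right_mono order_trans[OF Tb abs_ge_self])
  qed measurable
  define a where "a R = (\<integral>\<xi>. T R \<xi> * h \<xi> \<partial>lborel)" for R
  have a1: "(a \<longlongrightarrow> (\<integral>\<xi>. F \<xi> * h \<xi> \<partial>lborel)) at_top"
  proof -
    \<comment> \<open>The squared L2 norm of \<open>h\<close>. It is finite because
      \<open>|h| <= 1\<close> makes \<open>|h|^2\<close> at most the integrable
      \<open>|h|\<close>.\<close>
    define K where "K = (\<integral>\<^sup>+ \<xi>. (ennreal (norm (h \<xi>)))\<^sup>2 \<partial>lborel)"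
    have "K \<le> (\<integral>\<^sup>+ \<xi>. ennreal (norm (h \<xi>)) \<partial>lborel)"
      unfolding K_def using h1 by (intro nn_integral_mono) (simp add: power2_eq_square mult_left_le flip: ennreal_mult)
    also have "\<dots> < \<infinity>" using hi by (simp add: integrable_iff_bounded)
    finally have K: "K < \<infinity>" .
    have le: "ennreal ((norm (a R - (\<integral>\<xi>. F \<xi> * h \<xi> \<partial>lborel)))\<^sup>2)
        \<le> (\<integral>\<^sup>+ \<xi>. ennreal ((cmod (T R \<xi> - F \<xi>))\<^sup>2) \<partial>lborel) * K" for R
    proof -
      have "a R - (\<integral>\<xi>. F \<xi> * h \<xi> \<partial>lborel) = (\<integral>\<xi>. T R \<xi> * h \<xi> - F \<xi> * h \<xi> \<partial>lborel)"
        unfolding a_def using Th Fh by simp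
      also have "ennreal (norm \<dots>) \<le> (\<integral>\<^sup>+\<xi>. norm (T R \<xi> * h \<xi> - F \<xi> * h \<xi>) \<partial>lborel)"
        using Th Fh by (intro integral_norm_bound_ennreal) auto
      also have "\<dots> = (\<integral>\<^sup>+\<xi>. ennreal (norm (T R \<xi> - F \<xi>)) * ennreal (norm (h \<xi>)) \<partial>lborel)"
        by (intro nn_integral_cong) (simp add: left_diff_distrib[symmetric] norm_mult ennreal_mult)
      finally have "(ennreal (norm (a R - (\<integral>\<xi>. F \<xi> * h \<xi> \<partial>lborel))))\<^sup>2
          \<le> (\<integral>\<^sup>+\<xi>. ennreal (norm (T R \<xi> - F \<xi>)) * ennreal (norm (h \<xi>)) \<partial>lborel)\<^sup>2"
        by (intro power_mono) auto
      also have "\<dots> \<le> (\<integral>\<^sup>+\<xi>. (ennreal (norm (T R \<xi> - F \<xi>)))\<^sup>2 \<partial>lborel) * (\<integral>\<^sup>+\<xi>. (ennreal (norm (h \<xi>)))\<^sup>2 \<partial>lborel)"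
        by (rule Cauchy_Schwarz_nn_integral) measurable
      finally show ?thesis by (simp add: K_def ennreal_power)
    qed
    have "((\<lambda>R. (\<integral>\<^sup>+ \<xi>. ennreal ((cmod (T R \<xi> - F \<xi>))\<^sup>2) \<partial>lborel) * K) \<longlongrightarrow> 0 * K) at_top"
      using K by (intro tendsto_mult_ennreal lim) auto
    then have "((\<lambda>R. ennreal ((norm (a R - (\<integral>\<xi>. F \<xi> * h \<xi> \<partial>lborel)))\<^sup>2)) \<longlongrightarrow> 0) at_top"
      unfolding mult_zero_left by (rule tendsto_sandwich[OF _ _ tendsto_const, rotated 2]) (use le in simp_all)
    then have "((\<lambda>R. (norm (a R - (\<integral>\<xi>. F \<xi> * h \<xi> \<partial>lborel)))\<^sup>2) \<longlongrightarrow> 0) at_top"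
      by (intro tendsto_ennrealD) auto
    then have "((\<lambda>R. sqrt ((norm (a R - (\<integral>\<xi>. F \<xi> * h \<xi> \<partial>lborel)))\<^sup>2)) \<longlongrightarrow> sqrt 0) at_top"
      by (rule tendsto_real_sqrt)
    then show ?thesis by (simp add: LIM_zero_iff tendsto_norm_zero_iff)
  qed
  define v where "v y = complex_of_real (g y * (2 * pi * normal_density x s y))" for y
  have vm[measurable]: "v \<in> borel_measurable borel" unfolding v_def by measurable
  have gn: "integrable lborel (\<lambda>y. g y * normal_density x s y)"
    using s by (intro integrable_square_times_bounded[OF g2, where K = "1 / s"]) (auto simp: normal_density_le)
  have vi: "integrable lborel v"
  proof -
    have "integrable lborel (\<lambda>y. 2 * pi * (g y * normal_density x s y))"
      by (intro integrable_mult_right gn)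
    then have "integrable lborel (\<lambda>y. complex_of_real (2 * pi * (g y * normal_density x s y)))"
      by (rule integrable_of_real)
    moreover have "(\<lambda>y. complex_of_real (2 * pi * (g y * normal_density x s y))) = v"
      by (auto simp: v_def)
    ultimately show ?thesis by simp
  qed
  have "((\<lambda>R. (\<integral>y. indicator {-R..R} y *\<^sub>R v y \<partial>lborel)) \<longlongrightarrow> (\<integral>y. v y \<partial>lborel)) at_top"
  proof (rule integral_dominated_convergence_at_top[where w = "\<lambda>y. norm (v y)"])
    show "AE y in lborel. ((\<lambda>R. indicator {-R..R} y *\<^sub>R v y) \<longlongrightarrow> v y) at_top"
    proof (rule AE_I2, rule tendsto_eventually)
      fix y :: real
      show "\<forall>\<^sub>F R in at_top. indicator {-R..R} y *\<^sub>R v y = v y"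
        using eventually_ge_at_top[of "\<bar>y\<bar>"] by eventually_elim (auto simp: indicator_def)
    qed
    show "\<forall>\<^sub>F R in at_top. AE y in lborel. norm (indicator {-R..R} y *\<^sub>R v y) \<le> norm (v y)"
      by (auto simp: indicator_def)
  qed (use vi in auto)
  moreover have "(\<integral>y. indicator {-R..R} y *\<^sub>R v y \<partial>lborel) = a R" for R
    using truncated_fourier_gaussian[OF g s, of R x]
    unfolding a_def T_def h_def v_def set_lebesgue_integral_def by simp
  ultimately have a2: "(a \<longlongrightarrow> (\<integral>y. v y \<partial>lborel)) at_top" by simp
  have "(\<integral>\<xi>. F \<xi> * h \<xi> \<partial>lborel) = (\<integral>y. v y \<partial>lborel)"
    using tendsto_unique[OF _ a1 a2] by simp
  also have "\<dots> = complex_of_real (\<integral>y. 2 * pi * (g y * normal_density x s y) \<partial>lborel)"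
  proof -
    have "v = (\<lambda>y. complex_of_real (2 * pi * (g y * normal_density x s y)))" by (auto simp: v_def)
    then show ?thesis by (simp only:) (intro integral_of_real integrable_mult_right gn)
  qed
  also have "(\<integral>y. 2 * pi * (g y * normal_density x s y) \<partial>lborel) = 2 * pi * (\<integral>y. g y * normal_density x s y \<partial>lborel)"
    by (rule integral_mult_right_zero)
  finally show ?thesis by (simp add: h_def)
qed

section \<open>Approximate identity and pointwise inversion\<close>

text \<open>The exponential is split into two equal factors. One, by
  \<open>exp (-r) <= 1 / r\<close>, beats the prefactor \<open>1 / s\<close> and leaves a spare
  \<open>s\<close>; the other is at most a fixed Gaussian because \<open>s <= 1\<close>.\<close>

lemma normal_density_le_off_center:
  assumes s: "0 < s" "s \<le> 1" and d: "0 < d" "d \<le> \<bar>y - x\<bar>"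
  shows "normal_density x s y \<le> 4 * s / d\<^sup>2 * exp (- (y - x)\<^sup>2 / 4)"
proof -
  define D where "D = (y - x)\<^sup>2"
  have D: "d\<^sup>2 \<le> D" using d unfolding D_def by (intro abs_le_square_iff[THEN iffD1]) auto
  have Dp: "0 < D" using D d by (meson less_le_trans zero_less_power)
  have s2: "s\<^sup>2 \<le> 1" using s by (simp add: power_le_one)
  have "exp (- D / (2 * s\<^sup>2)) = exp (- (D / (4 * s\<^sup>2))) * exp (- (D / (4 * s\<^sup>2)))"
    using s by (simp add: exp_add[symmetric] field_simps)
  also have "\<dots> \<le> (4 * s\<^sup>2 / d\<^sup>2) * exp (- D / 4)"
  proof (intro mult_mono)
    have "d\<^sup>2 / (4 * s\<^sup>2) \<le> D / (4 * s\<^sup>2)" using D s by (simp add: divide_right_mono)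
    also have "\<dots> \<le> exp (D / (4 * s\<^sup>2))" using exp_ge_add_one_self[of "D / (4 * s\<^sup>2)"] by linarith
    finally have "inverse (exp (D / (4 * s\<^sup>2))) \<le> inverse (d\<^sup>2 / (4 * s\<^sup>2))"
      using s d by (intro le_imp_inverse_le) auto
    then show "exp (- (D / (4 * s\<^sup>2))) \<le> 4 * s\<^sup>2 / d\<^sup>2" by (simp add: exp_minus)
    have "D / 4 \<le> D / (4 * s\<^sup>2)" using s s2 Dp by (intro divide_left_mono) auto
    then show "exp (- (D / (4 * s\<^sup>2))) \<le> exp (- D / 4)" by simp
  qed auto
  finally have e: "exp (- D / (2 * s\<^sup>2)) \<le> (4 * s\<^sup>2 / d\<^sup>2) * exp (- D / 4)" .
  have "1 \<le> sqrt (2 * pi)" using pi_gt3 by (simp add: real_le_rsqrt)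
  then have "1 / (sqrt (2 * pi) * s) \<le> 1 / (1 * s)"
    using s by (intro divide_left_mono mult_right_mono) auto
  then have "1 / (sqrt (2 * pi) * s) * exp (- D / (2 * s\<^sup>2)) \<le> 1 / (1 * s) * ((4 * s\<^sup>2 / d\<^sup>2) * exp (- D / 4))"
    using e s by (intro mult_mono) auto
  also have "\<dots> = 4 * s / d\<^sup>2 * exp (- D / 4)" using s by (simp add: power2_eq_square)
  finally show ?thesis using s by (simp add: normal_density_def real_sqrt_mult D_def)
qed

text \<open>No bound on \<open>g\<close> is at hand away from \<open>x\<close>, only square
  integrability. The tail is therefore dominated by \<open>s\<close> times a multiple of
  \<open>H\<close>, which is integrable and does not depend on \<open>s\<close>.\<close>

lemma gaussian_approximate_identity:
  fixes g :: "real \<Rightarrow> real"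
  assumes g: "continuous_on UNIV g" and g2: "square_integrable g"
  shows "(\<lambda>n. \<integral>y. g y * normal_density x (1 / real (Suc n)) y \<partial>lborel) \<longlonglongrightarrow> g x"
proof -
  define H where "H y = (\<bar>g y\<bar> + \<bar>g x\<bar>) * exp (- (y - x)\<^sup>2 / 4)" for y
  have H0: "0 \<le> H y" for y by (simp add: H_def)
  have ei: "integrable lborel (\<lambda>y. exp (- (y - x)\<^sup>2 / 4))"
  proof -
    have "(\<lambda>y. exp (- (y - x)\<^sup>2 / 4)) = (\<lambda>y. sqrt (4 * pi) * normal_density x (sqrt 2) y)"
      by (auto simp: normal_density_def)
    then show ?thesis by (simp del: real_sqrt_mult)
  qed
  have "integrable lborel (\<lambda>y. \<bar>g y * exp (- (y - x)\<^sup>2 / 4)\<bar>)"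
    by (intro integrable_abs integrable_square_times_bounded[OF g2 ei, where K = 1]) auto
  with ei have Hi: "integrable lborel H"
    unfolding H_def by (simp add: abs_mult distrib_right)
  \<comment> \<open>\<open>\<eta>\<close> is the oscillation of \<open>g\<close> within distance
    \<open>d\<close> of \<open>x\<close>; the second term is the contribution from outside, which
    vanishes with \<open>s\<close>.\<close>
  have key: "\<bar>(\<integral>y. g y * normal_density x s y \<partial>lborel) - g x\<bar> \<le> \<eta> + s * (4 / d\<^sup>2 * (\<integral>y. H y \<partial>lborel))"
    if s: "0 < s" "s \<le> 1" and d: "0 < d" "\<And>y. \<bar>y - x\<bar> < d \<Longrightarrow> \<bar>g y - g x\<bar> \<le> \<eta>" for s d \<eta>
  proof -
    have gn: "integrable lborel (\<lambda>y. g y * normal_density x s y)"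
      using s by (intro integrable_square_times_bounded[OF g2, where K = "1 / s"]) (auto simp: normal_density_le)
    have "0 \<le> \<eta>" using d(2)[of x] d(1) by simp
    have ni: "integrable lborel (normal_density x s)" "(\<integral>y. normal_density x s y \<partial>lborel) = 1" using s by auto
    have "(\<integral>y. g y * normal_density x s y \<partial>lborel) - g x
        = (\<integral>y. g y * normal_density x s y \<partial>lborel) - (\<integral>y. g x * normal_density x s y \<partial>lborel)"
      using ni by simp
    also have "\<dots> = (\<integral>y. g y * normal_density x s y - g x * normal_density x s y \<partial>lborel)"
      using gn ni by simp
    also have "\<bar>\<dots>\<bar> \<le> (\<integral>y. \<bar>g y * normal_density x s y - g x * normal_density x s y\<bar> \<partial>lborel)"
      by (rule integral_abs_bound)
    also have "\<dots> \<le> (\<integral>y. \<eta> * normal_density x s y + s * (4 / d\<^sup>2 * H y) \<partial>lborel)"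
    proof (rule integral_mono)
      fix y
      have n0: "0 \<le> normal_density x s y" by simp
      have "\<bar>g y * normal_density x s y - g x * normal_density x s y\<bar> = \<bar>g y - g x\<bar> * normal_density x s y"
        by (simp add: abs_mult flip: left_diff_distrib)
      also have "\<dots> \<le> \<eta> * normal_density x s y + s * (4 / d\<^sup>2 * H y)"
      proof (cases "\<bar>y - x\<bar> < d")
        case True
        then have "\<bar>g y - g x\<bar> * normal_density x s y \<le> \<eta> * normal_density x s y"
          using d(2) n0 by (intro mult_right_mono) auto
        moreover have "0 \<le> s * (4 / d\<^sup>2 * H y)" using s H0 by simp
        ultimately show ?thesis by linarith
      next
        case False
        then have "\<bar>g y - g x\<bar> * normal_density x s y \<le> (\<bar>g y\<bar> + \<bar>g x\<bar>) * (4 * s / d\<^sup>2 * exp (- (y - x)\<^sup>2 / 4))"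
          using normal_density_le_off_center[OF s d(1), of y x] n0 by (intro mult_mono) auto
        also have "\<dots> = s * (4 / d\<^sup>2 * H y)" by (simp add: H_def)
        moreover have "0 \<le> \<eta> * normal_density x s y" using \<open>0 \<le> \<eta>\<close> n0 by simp
        ultimately show ?thesis by linarith
      qed
      finally show "\<bar>g y * normal_density x s y - g x * normal_density x s y\<bar> \<le> \<eta> * normal_density x s y + s * (4 / d\<^sup>2 * H y)" .
    qed (use gn ni Hi in \<open>auto intro!: integrable_abs Bochner_Integration.integrable_diff Bochner_Integration.integrable_add integrable_mult_right\<close>)
    also have "\<dots> = \<eta> + s * (4 / d\<^sup>2 * (\<integral>y. H y \<partial>lborel))"
    proof -
      have "(\<integral>y. \<eta> * normal_density x s y + s * (4 / d\<^sup>2 * H y) \<partial>lborel) =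
          (\<integral>y. \<eta> * normal_density x s y \<partial>lborel) + (\<integral>y. s * (4 / d\<^sup>2 * H y) \<partial>lborel)"
        using ni Hi by (intro Bochner_Integration.integral_add integrable_mult_right)
      then show ?thesis using ni by simp
    qed
    finally show ?thesis .
  qed
  show ?thesis
  proof (rule LIMSEQ_I)
    fix r :: real assume r: "0 < r"
    have "isCont g x" using g by (simp add: continuous_on_eq_continuous_at)
    then obtain d where d: "0 < d" "\<And>y. \<bar>y - x\<bar> < d \<Longrightarrow> \<bar>g y - g x\<bar> < r / 2"
      using r unfolding continuous_at_eps_delta dist_real_def by (meson half_gt_zero)
    define K where "K = 4 / d\<^sup>2 * (\<integral>y. H y \<partial>lborel)"
    have "(\<lambda>n. 1 / real (Suc n) * K) \<longlonglongrightarrow> 0 * K"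
      by (intro tendsto_mult_right) (rule LIMSEQ_Suc[OF lim_1_over_n])
    from LIMSEQ_D[OF this, of "r / 2"] r
    obtain n0 where n0: "\<And>n. n \<ge> n0 \<Longrightarrow> \<bar>1 / real (Suc n) * K\<bar> < r / 2"
      unfolding mult_zero_left diff_zero real_norm_def by (meson half_gt_zero)
    show "\<exists>no. \<forall>n\<ge>no. norm ((\<integral>y. g y * normal_density x (1 / real (Suc n)) y \<partial>lborel) - g x) < r"
    proof (intro exI allI impI)
      fix n assume "n \<ge> n0"
      have "\<bar>(\<integral>y. g y * normal_density x (1 / real (Suc n)) y \<partial>lborel) - g x\<bar> \<le> r / 2 + 1 / real (Suc n) * K"
        unfolding K_def using d by (intro key) (auto intro: less_imp_le)
      then show "norm ((\<integral>y. g y * normal_density x (1 / real (Suc n)) y \<partial>lborel) - g x) < r"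
        using n0[OF \<open>n \<ge> n0\<close>] unfolding real_norm_def by linarith
    qed
  qed
qed

text \<open>The witness is the transform cut off to \<open>[-c, c]\<close>, so that it vanishes
  outside everywhere and not just almost everywhere. On a bounded interval square integrability
  implies integrability, and this \<open>G\<close> dominates the damped integrands as the damping
  \<open>s = 1 / (n + 1)\<close> tends to 0.\<close>

lemma bandlimited_inversion:
  assumes g: "bandlimited c g"
  obtains F where "F \<in> borel_measurable borel" "integrable lborel (\<lambda>\<xi>. (cmod (F \<xi>))\<^sup>2)" "integrable lborel F"
    "\<And>\<xi>. \<xi> \<notin> {-c..c} \<Longrightarrow> F \<xi> = 0" "\<And>x. complex_of_real (2 * pi * g x) = (\<integral>\<xi>. F \<xi> * iexp (x * \<xi>) \<partial>lborel)"
proof -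
  obtain F where F: "is_fourier_transform g F" "AE \<xi> in lborel. \<xi> \<notin> {-c..c} \<longrightarrow> F \<xi> = 0"
    and gc: "continuous_on UNIV g" and g2: "square_integrable g"
    using g unfolding bandlimited_def by blast
  have [measurable]: "F \<in> borel_measurable borel" and F2: "integrable lborel (\<lambda>\<xi>. (cmod (F \<xi>))\<^sup>2)"
    using F by (auto simp: is_fourier_transform_def square_integrable_def)
  define G where "G \<xi> = indicator {-c..c} \<xi> *\<^sub>R F \<xi>" for \<xi>
  have Gm[measurable]: "G \<in> borel_measurable borel" unfolding G_def by measurable
  have G2: "integrable lborel (\<lambda>\<xi>. (cmod (G \<xi>))\<^sup>2)"
    by (rule Bochner_Integration.integrable_bound[OF F2]) (auto simp: G_def indicator_def)
  have Gi: "integrable lborel G"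
  proof (rule Bochner_Integration.integrable_bound)
    show "integrable lborel (\<lambda>\<xi>. indicator {-c..c} \<xi> + (cmod (G \<xi>))\<^sup>2)"
      using G2 by (intro Bochner_Integration.integrable_add) (auto intro!: integrable_real_indicator simp: emeasure_lborel_Icc_eq)
    show "AE \<xi> in lborel. norm (G \<xi>) \<le> norm (indicator {-c..c} \<xi> + (cmod (G \<xi>))\<^sup>2)"
    proof (rule AE_I2)
      fix \<xi>
      have "0 \<le> (cmod (F \<xi>) - 1)\<^sup>2" by simp
      then have "2 * cmod (F \<xi>) \<le> 1 + (cmod (F \<xi>))\<^sup>2" by (simp add: power2_diff)
      moreover have "0 \<le> cmod (F \<xi>)" by simp
      ultimately have "cmod (F \<xi>) \<le> 1 + (cmod (F \<xi>))\<^sup>2" by linarith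
      then show "norm (G \<xi>) \<le> norm (indicator {-c..c} \<xi> + (cmod (G \<xi>))\<^sup>2)"
        by (auto simp: G_def indicator_def)
    qed
  qed measurable
  have FG: "AE \<xi> in lborel. F \<xi> = G \<xi>"
    using F(2) by eventually_elim (auto simp: G_def indicator_def)
  have "complex_of_real (2 * pi * g x) = (\<integral>\<xi>. G \<xi> * iexp (x * \<xi>) \<partial>lborel)" for x
  proof -
    define a where "a n = (\<integral>\<xi>. G \<xi> * (exp (- (1 / real (Suc n) * \<xi>)\<^sup>2 / 2) *\<^sub>R iexp (x * \<xi>)) \<partial>lborel)" for n
    have a: "a n = complex_of_real (2 * pi * (\<integral>y. g y * normal_density x (1 / real (Suc n)) y \<partial>lborel))" for n
    proof -
      have "a n = (\<integral>\<xi>. F \<xi> * (exp (- (1 / real (Suc n) * \<xi>)\<^sup>2 / 2) *\<^sub>R iexp (x * \<xi>)) \<partial>lborel)"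
        unfolding a_def by (rule integral_cong_AE) (use FG in \<open>auto\<close>)
      also have "\<dots> = complex_of_real (2 * pi * (\<integral>y. g y * normal_density x (1 / real (Suc n)) y \<partial>lborel))"
        by (rule fourier_transform_gaussian[OF gc F(1)]) simp
      finally show ?thesis .
    qed
    have "(\<lambda>n. complex_of_real (2 * pi * (\<integral>y. g y * normal_density x (1 / real (Suc n)) y \<partial>lborel))) \<longlonglongrightarrow> complex_of_real (2 * pi * g x)"
      by (intro tendsto_intros gaussian_approximate_identity gc g2)
    then have 1: "a \<longlonglongrightarrow> complex_of_real (2 * pi * g x)" using a by presburger
    have 2: "a \<longlonglongrightarrow> (\<integral>\<xi>. G \<xi> * iexp (x * \<xi>) \<partial>lborel)"
      unfolding a_def
    proof (rule integral_dominated_convergence[where w = "\<lambda>\<xi>. norm (G \<xi>)"])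
      show "AE \<xi> in lborel. (\<lambda>n. G \<xi> * (exp (- (1 / real (Suc n) * \<xi>)\<^sup>2 / 2) *\<^sub>R iexp (x * \<xi>))) \<longlonglongrightarrow> G \<xi> * iexp (x * \<xi>)"
      proof (rule AE_I2)
        fix \<xi> :: real
        have "(\<lambda>n. 1 / real (Suc n)) \<longlonglongrightarrow> 0" by (rule LIMSEQ_Suc[OF lim_1_over_n])
        then have "(\<lambda>n. G \<xi> * (exp (- (1 / real (Suc n) * \<xi>)\<^sup>2 / 2) *\<^sub>R iexp (x * \<xi>))) \<longlonglongrightarrow> G \<xi> * (exp (- (0 * \<xi>)\<^sup>2 / 2) *\<^sub>R iexp (x * \<xi>))"
          by (intro tendsto_mult tendsto_scaleR tendsto_exp tendsto_const tendsto_divide tendsto_minus tendsto_power) auto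
        then show "(\<lambda>n. G \<xi> * (exp (- (1 / real (Suc n) * \<xi>)\<^sup>2 / 2) *\<^sub>R iexp (x * \<xi>))) \<longlonglongrightarrow> G \<xi> * iexp (x * \<xi>)" by simp
      qed
      show "AE \<xi> in lborel. norm (G \<xi> * (exp (- (1 / real (Suc n) * \<xi>)\<^sup>2 / 2) *\<^sub>R iexp (x * \<xi>))) \<le> norm (G \<xi>)" for n
        by (rule AE_I2) (simp add: norm_mult mult_left_le_one_le del: of_nat_Suc)
    qed (use Gi in auto)
    from 1 2 show ?thesis by (rule LIMSEQ_unique)
  qed
  then show thesis using that[of G] G2 Gi by (auto simp: G_def indicator_def)
qed

section \<open>A lower Stirling bound\<close>

text \<open>The logarithm is concave, so its value at the midpoint \<open>u\<close> dominates its mean over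
  \<open>[u - 1/2, u + 1/2]\<close>.\<close>

lemma ln_ge_midpoint:
  fixes u :: real
  assumes "1 \<le> u"
  shows "(u + 1/2) * ln (u + 1/2) - (u - 1/2) * ln (u - 1/2) - 1 \<le> ln u"
proof -
  \<comment> \<open>\<open>f h\<close> is the integral of \<open>ln\<close> over
    \<open>[u - h, u + h]\<close> minus \<open>2 h ln u\<close>; its derivative is nonpositive by
    \<open>(u + h) (u - h) <= u^2\<close>.\<close>
  define f where "f h = (u + h) * ln (u + h) - (u - h) * ln (u - h) - 2 * h - 2 * h * ln u" for h
  have "f (1/2) \<le> f 0"
  proof (rule DERIV_nonpos_imp_nonincreasing[of 0 "1/2" f])
    fix h :: real assume h: "0 \<le> h" "h \<le> 1/2"
    have pos: "0 < u + h" "0 < u - h" using h assms by auto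
    have "((\<lambda>h. (u + h) * ln (u + h)) has_real_derivative (ln (u + h) + 1)) (at h)"
      using pos by (auto intro!: derivative_eq_intros)
    moreover have "((\<lambda>h. (u - h) * ln (u - h)) has_real_derivative (- ln (u - h) - 1)) (at h)"
      using pos by (auto intro!: derivative_eq_intros)
    ultimately have "(f has_real_derivative (ln (u + h) + ln (u - h) - 2 * ln u)) (at h)"
      unfolding f_def using pos by (auto intro!: derivative_eq_intros)
    moreover have "ln (u + h) + ln (u - h) \<le> 2 * ln u"
    proof -
      have "ln (u + h) + ln (u - h) = ln ((u + h) * (u - h))"
        using h assms by (simp add: ln_mult)
      also have "\<dots> \<le> ln (u * u)"
        using h assms by (subst ln_le_cancel_iff) (auto simp: algebra_simps intro!: add_pos_nonneg mult_strict_mono)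
      also have "\<dots> = 2 * ln u" using assms by (simp add: ln_mult)
      finally show ?thesis .
    qed
    ultimately show "\<exists>y. (f has_real_derivative y) (at h) \<and> y \<le> 0" by fastforce
  qed simp
  then show ?thesis by (simp add: f_def)
qed

text \<open>The midpoint inequality bounds each \<open>ln m\<close> below by
  \<open>\<phi> m - \<phi> (m - 1)\<close>, and the sum over \<open>m\<close> telescopes. The half
  in \<open>n + 1/2\<close> becomes the factor \<open>sqrt n\<close>; the value of \<open>k\<close>
  is immaterial.\<close>

lemma fact_ge_stirling:
  obtains k :: real where "0 < k" "\<And>n. 0 < n \<Longrightarrow> k * sqrt (real n) * (real n / exp 1) ^ n \<le> fact n"
proof -
  define \<phi> :: "real \<Rightarrow> real" where "\<phi> u = (u + 1/2) * ln (u + 1/2) - u" for u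
  have *: "\<phi> (real (Suc n)) - \<phi> 1 \<le> ln (fact (Suc n))" for n
  proof (induction n)
    case (Suc n)
    have "\<phi> (real (Suc (Suc n))) - \<phi> (real (Suc n)) \<le> ln (real (Suc (Suc n)))"
      using ln_ge_midpoint[of "real (Suc (Suc n))"] by (simp add: \<phi>_def)
    moreover have "ln (fact (Suc (Suc n)) :: real) = ln (real (Suc (Suc n))) + ln (fact (Suc n))"
      unfolding fact_Suc[of "Suc n"] of_nat_mult by (rule ln_mult_pos) auto
    ultimately show ?case using Suc by linarith
  qed simp
  show thesis
  proof (rule that[of "exp (- \<phi> 1)"])
    fix n :: nat assume n: "0 < n"
    have "(n + 1/2) * ln n \<le> (n + 1/2) * ln (real n + 1/2)" using n by (intro mult_left_mono) auto
    moreover have "\<phi> n - \<phi> 1 \<le> ln (fact n)" using *[of "n - 1"] n by simp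
    moreover have "\<phi> n = (n + 1/2) * ln (real n + 1/2) - n" by (simp add: \<phi>_def)
    ultimately have "(n + 1/2) * ln n - n - \<phi> 1 \<le> ln (fact n)" by linarith
    then have "exp ((n + 1/2) * ln n - n - \<phi> 1) \<le> fact n"
      by (metis exp_le_cancel_iff exp_ln fact_gt_zero)
    also have "(n + 1/2) * ln n - n - \<phi> 1 = - \<phi> 1 + ln (sqrt n) + n * (ln n - 1)"
      using n by (simp add: ln_sqrt algebra_simps)
    also have "exp \<dots> = exp (- \<phi> 1) * sqrt n * (real n / exp 1) ^ n"
    proof -
      have "exp (n * (ln n - 1)) = (real n / exp 1) ^ n" using n by (simp add: exp_of_nat_mult exp_diff)
      moreover have "exp (ln (sqrt n)) = sqrt n" using n by simp
      ultimately show ?thesis by (simp only: exp_add)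
    qed
    finally show "exp (- \<phi> 1) * sqrt (real n) * (real n / exp 1) ^ n \<le> fact n" .
  qed simp
qed

section \<open>Polynomial approximation of bandlimited functions\<close>

text \<open>The phase \<open>\<phi>\<close> serves two ends: differentiation only shifts it by
  \<open>pi / 2\<close>, and the values 0 and \<open>- pi / 2\<close> give the real and the
  imaginary part of the exponential.\<close>

lemma cos_interpolation_error:
  assumes n: "0 < n" and x: "\<bar>x\<bar> \<le> 1"
  shows "\<bar>cos (x * \<xi> + \<phi>) - (\<Sum>j<n. cos (chebyshev_node n j * \<xi> + \<phi>) * poly (lagrange n j) x)\<bar>
     \<le> \<bar>\<xi>\<bar> ^ n / (fact n * 2 ^ (n - 1))"
proof -
  define f where "f k x = \<xi> ^ k * cos (x * \<xi> + \<phi> + real k * (pi / 2))" for k and x :: real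
  have "\<bar>f 0 x - poly (interpolant n (f 0)) x\<bar> \<le> \<bar>\<xi>\<bar> ^ n / (fact n * 2 ^ (n - 1))"
  proof (rule chebyshev_interpolation_error[OF n x])
    fix k and x :: real
    have c: "cos (x * \<xi> + \<phi> + real (Suc k) * (pi / 2)) = - sin (x * \<xi> + \<phi> + real k * (pi / 2))"
    proof -
      have "x * \<xi> + \<phi> + real (Suc k) * (pi / 2) = (x * \<xi> + \<phi> + real k * (pi / 2)) + pi / 2"
        by (simp add: algebra_simps add_divide_distrib)
      then show ?thesis by (simp only: cos_add) simp
    qed
    show "(f k has_real_derivative f (Suc k) x) (at x)"
      unfolding f_def c by (auto intro!: derivative_eq_intros)
    show "\<bar>f n x\<bar> \<le> \<bar>\<xi>\<bar> ^ n"
      unfolding f_def abs_mult power_abs[symmetric] by (intro mult_left_le abs_cos_le_one) simp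
  qed
  then show ?thesis by (simp add: f_def interpolant_def poly_sum)
qed

lemma iexp_interpolation_error:
  assumes n: "0 < n" and x: "\<bar>x\<bar> \<le> 1"
  shows "cmod (iexp (x * \<xi>) - (\<Sum>j<n. iexp (chebyshev_node n j * \<xi>) * complex_of_real (poly (lagrange n j) x)))
     \<le> 2 * (\<bar>\<xi>\<bar> ^ n / (fact n * 2 ^ (n - 1)))"
    (is "cmod ?z \<le> 2 * ?K")
proof -
  have Re: "\<bar>Re ?z\<bar> \<le> ?K"
    using cos_interpolation_error[OF n x, of \<xi> 0] by (simp add: Re_exp)
  have Im: "\<bar>Im ?z\<bar> \<le> ?K"
    using cos_interpolation_error[OF n x, of \<xi> "- (pi / 2)"] by (simp add: Im_exp cos_diff)
  show ?thesis using cmod_le[of ?z] Re Im by linarith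
qed

lemma integral_even_power:
  assumes "0 < c"
  shows "(\<integral>\<xi>. \<xi> ^ (2 * n) * indicator {-c..c} \<xi> \<partial>lborel) = 2 * c ^ (2 * n + 1) / real (2 * n + 1)"
  using assms integral_power[of "-c" c "2 * n"] by simp

text \<open>The Cauchy-Schwarz estimate in \<open>\<xi>\<close> is carried out pointwise in this
  form, with the weight \<open>t\<close> chosen to balance the two integrals.\<close>

lemma weighted_am_gm:
  fixes a b t :: real
  assumes "0 < t" shows "a * (2 * b) \<le> t * a\<^sup>2 + 1 / t * b\<^sup>2"
proof -
  have "t * a\<^sup>2 + 1 / t * b\<^sup>2 - a * (2 * b) = (t * a - b)\<^sup>2 / t"
    using assms by (simp add: field_simps power2_eq_square)
  moreover have "0 \<le> (t * a - b)\<^sup>2 / t" using assms by simp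
  ultimately show ?thesis by linarith
qed

lemma bandlimited_interpolation_error:
  assumes g: "bandlimited c g" and c: "0 < c"
  obtains K where "0 \<le> K"
    "\<And>n x. 0 < n \<Longrightarrow> \<bar>x\<bar> \<le> 1 \<Longrightarrow>
       \<bar>g x - poly (interpolant n g) x\<bar> \<le> K * (sqrt (c ^ (2 * n + 1) / real (2 * n + 1)) / (fact n * 2 ^ n))"
proof -
  obtain F where Fm[measurable]: "F \<in> borel_measurable borel" and F2: "integrable lborel (\<lambda>\<xi>. (cmod (F \<xi>))\<^sup>2)"
    and Fi: "integrable lborel F" and F0: "\<And>\<xi>. \<xi> \<notin> {-c..c} \<Longrightarrow> F \<xi> = 0"
    and inv: "\<And>x. complex_of_real (2 * pi * g x) = (\<integral>\<xi>. F \<xi> * iexp (x * \<xi>) \<partial>lborel)"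
    using bandlimited_inversion[OF g] by blast
  define A where "A = (\<integral>\<xi>. (cmod (F \<xi>))\<^sup>2 \<partial>lborel)"
  have A: "0 \<le> A" by (simp add: A_def)
  show thesis
  proof (rule that[of "2 / pi * (A / 2 + 1)"])
    show "0 \<le> 2 / pi * (A / 2 + 1)" using A by simp
    fix n :: nat and x :: real assume n: "0 < n" and x: "\<bar>x\<bar> \<le> 1"
    \<comment> \<open>The integral of \<open>\<xi> ^ (2 * n)\<close> over \<open>[-c, c]\<close> is
      \<open>2 t^2\<close>, so the two terms of the weighted inequality integrate to
      \<open>t A\<close> and \<open>2 t\<close>, both proportional to \<open>t\<close>.\<close>
    define t where "t = sqrt (c ^ (2 * n + 1) / real (2 * n + 1))"
    have t: "0 < t" using c by (simp add: t_def)
    have t2: "t * t = c ^ (2 * n + 1) / real (2 * n + 1)" using c by (simp add: t_def)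
    define r where "r \<xi> = iexp (x * \<xi>) - (\<Sum>j<n. iexp (chebyshev_node n j * \<xi>) * complex_of_real (poly (lagrange n j) x))" for \<xi>
    have rm[measurable]: "r \<in> borel_measurable borel" unfolding r_def by measurable
    have Fe: "integrable lborel (\<lambda>\<xi>. F \<xi> * iexp (y * \<xi>))" for y
      using Fi by (subst integrable_norm_iff[symmetric]) (auto simp: norm_mult)
    define I where "I = (\<integral>\<xi>. F \<xi> * r \<xi> \<partial>lborel)"
    have "complex_of_real (2 * pi * (g x - poly (interpolant n g) x)) = I"
    proof -
      have "I = (\<integral>\<xi>. F \<xi> * iexp (x * \<xi>) - (\<Sum>j<n. F \<xi> * iexp (chebyshev_node n j * \<xi>) * complex_of_real (poly (lagrange n j) x)) \<partial>lborel)"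
        unfolding I_def r_def by (simp add: right_diff_distrib sum_distrib_left mult.assoc)
      also have "\<dots> = (\<integral>\<xi>. F \<xi> * iexp (x * \<xi>) \<partial>lborel) - (\<Sum>j<n. (\<integral>\<xi>. F \<xi> * iexp (chebyshev_node n j * \<xi>) \<partial>lborel) * complex_of_real (poly (lagrange n j) x))"
        using Fe by (subst Bochner_Integration.integral_diff) (auto intro!: Bochner_Integration.integrable_sum integrable_mult_left)
      also have "\<dots> = complex_of_real (2 * pi * (g x - poly (interpolant n g) x))"
        unfolding inv[symmetric] by (simp add: interpolant_def poly_sum sum_distrib_left algebra_simps)
      finally show ?thesis by simp
    qed
    then have "2 * pi * \<bar>g x - poly (interpolant n g) x\<bar> = cmod I"
      by (metis norm_of_real abs_mult abs_of_pos mult_pos_pos pi_gt_zero zero_less_numeral)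
    also have "\<dots> \<le> (\<integral>\<xi>. cmod (F \<xi> * r \<xi>) \<partial>lborel)" unfolding I_def by (rule integral_norm_bound)
    also have "\<dots> \<le> (\<integral>\<xi>. (t * (cmod (F \<xi>))\<^sup>2 + 1 / t * (\<xi> ^ (2 * n) * indicator {-c..c} \<xi>)) * (1 / (fact n * 2 ^ (n - 1))) \<partial>lborel)"
    proof (rule integral_mono')
      have "integrable lborel (\<lambda>\<xi>. \<xi> ^ (2 * n) * indicator {-c..c} \<xi>)"
        by (rule borel_integrable_atLeastAtMost) auto
      then show "integrable lborel (\<lambda>\<xi>. (t * (cmod (F \<xi>))\<^sup>2 + 1 / t * (\<xi> ^ (2 * n) * indicator {-c..c} \<xi>)) * (1 / (fact n * 2 ^ (n - 1))))"
        using F2 by (intro integrable_mult_left Bochner_Integration.integrable_add integrable_mult_right)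
      fix \<xi> :: real
      show "cmod (F \<xi> * r \<xi>) \<le> (t * (cmod (F \<xi>))\<^sup>2 + 1 / t * (\<xi> ^ (2 * n) * indicator {-c..c} \<xi>)) * (1 / (fact n * 2 ^ (n - 1)))"
      proof (cases "\<xi> \<in> {-c..c}")
        case True
        have "(\<bar>\<xi>\<bar> ^ n)\<^sup>2 = \<xi> ^ (2 * n)"
          by (simp add: power_mult[symmetric] mult.commute[of n 2] power_even_abs del: power_abs)
        then have "cmod (F \<xi>) * (2 * \<bar>\<xi>\<bar> ^ n) \<le> t * (cmod (F \<xi>))\<^sup>2 + 1 / t * \<xi> ^ (2 * n)"
          using weighted_am_gm[OF t, of "cmod (F \<xi>)" "\<bar>\<xi>\<bar> ^ n"] by simp
        then have "cmod (F \<xi>) * (2 * \<bar>\<xi>\<bar> ^ n) * (1 / (fact n * 2 ^ (n - 1))) \<le> (t * (cmod (F \<xi>))\<^sup>2 + 1 / t * \<xi> ^ (2 * n)) * (1 / (fact n * 2 ^ (n - 1)))"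
          by (intro mult_right_mono) auto
        moreover have "cmod (F \<xi> * r \<xi>) \<le> cmod (F \<xi>) * (2 * (\<bar>\<xi>\<bar> ^ n / (fact n * 2 ^ (n - 1))))"
          unfolding norm_mult r_def by (intro mult_left_mono iexp_interpolation_error[OF n x]) auto
        ultimately show ?thesis using True by simp
      qed (simp add: F0)
      have "0 \<le> \<xi> ^ (2 * n)" by simp
      then show "0 \<le> (t * (cmod (F \<xi>))\<^sup>2 + 1 / t * (\<xi> ^ (2 * n) * indicator {-c..c} \<xi>)) * (1 / (fact n * 2 ^ (n - 1)))"
        using t by (intro mult_nonneg_nonneg add_nonneg_nonneg) auto
    qed
    also have "\<dots> = (t * A + 1 / t * (2 * c ^ (2 * n + 1) / real (2 * n + 1))) * (1 / (fact n * 2 ^ (n - 1)))"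
    proof -
      have i: "integrable lborel (\<lambda>\<xi>. \<xi> ^ (2 * n) * indicator {-c..c} \<xi>)"
        by (rule borel_integrable_atLeastAtMost) auto
      have "(\<integral>\<xi>. t * (cmod (F \<xi>))\<^sup>2 + 1 / t * (\<xi> ^ (2 * n) * indicator {-c..c} \<xi>) \<partial>lborel) =
         (\<integral>\<xi>. t * (cmod (F \<xi>))\<^sup>2 \<partial>lborel) + (\<integral>\<xi>. 1 / t * (\<xi> ^ (2 * n) * indicator {-c..c} \<xi>) \<partial>lborel)"
        using F2 i by (intro Bochner_Integration.integral_add integrable_mult_right)
      then show ?thesis
        by (simp only: integral_mult_left_zero integral_mult_right_zero integral_even_power[OF c] A_def)
    qed
    also have "1 / t * (2 * c ^ (2 * n + 1) / real (2 * n + 1)) = 2 * t"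
    proof -
      have "2 * c ^ (2 * n + 1) / real (2 * n + 1) = 2 * (t * t)" unfolding t2 by simp
      then show ?thesis using t by (simp only:) simp
    qed
    also have "(t * A + 2 * t) * (1 / (fact n * 2 ^ (n - 1))) = 2 * pi * (2 / pi * (A / 2 + 1) * (t / (fact n * 2 ^ n)))"
    proof -
      define P :: real where "P = fact n * 2 ^ (n - 1)"
      have "fact n * 2 ^ n = 2 * P" using n by (simp add: P_def power_eq_if)
      moreover have "P \<noteq> 0" by (simp add: P_def)
      ultimately show ?thesis unfolding P_def[symmetric] by (simp add: field_simps)
    qed
    finally have "\<bar>g x - poly (interpolant n g) x\<bar> \<le> 2 / pi * (A / 2 + 1) * (t / (fact n * 2 ^ n))"
      by (subst (asm) mult_le_cancel_left_pos) auto
    then show "\<bar>g x - poly (interpolant n g) x\<bar> \<le> 2 / pi * (A / 2 + 1) * (sqrt (c ^ (2 * n + 1) / real (2 * n + 1)) / (fact n * 2 ^ n))"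
      unfolding t_def .
  qed
qed

text \<open>By continuity the set where \<open>g\<close> is nonzero is open, and a null open set is
  empty. This settles the case in which one cannot divide by the norm.\<close>

lemma bandlimited_norm_zero:
  assumes g: "bandlimited c g" and 0: "L2_norm_real g = 0"
  shows "g x = 0"
proof -
  have gc: "continuous_on UNIV g" and gi: "integrable lborel (\<lambda>x. (g x)\<^sup>2)"
    using g by (auto simp: bandlimited_def square_integrable_def)
  have "(\<integral>x. (g x)\<^sup>2 \<partial>lborel) = 0" using 0 by (simp add: L2_norm_real_def)
  then have "AE x in lborel. g x = 0"
    using integral_nonneg_eq_0_iff_AE[OF gi] by simp
  then have "AE x in lborel. x \<notin> {x. g x \<noteq> 0}" by simp
  then have "{x. g x \<noteq> 0} \<in> null_sets lborel"
    using gc by (subst AE_iff_null_sets) (auto intro!: borel_open open_Collect_neq)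
  then have "negligible {x. g x \<noteq> 0}"
    by (simp add: negligible_iff_null_sets null_sets_completionI)
  moreover have "open {x. g x \<noteq> 0}" using gc by (intro open_Collect_neq) auto
  ultimately show ?thesis using open_not_negligible by blast
qed

text \<open>The interpolation bound is not homogeneous in \<open>g\<close>. Since \<open>K\<close>
  may depend on \<open>g\<close>, dividing by a nonzero L2 norm brings it to the required
  shape.\<close>

lemma bandlimited_polynomial_approximation:
  assumes g: "bandlimited c g" and c: "0 < c"
  obtains K where "0 \<le> K"
    "\<And>N. \<exists>p. Polynomial.degree p \<le> N \<and>
      (\<forall>x. \<bar>x\<bar> \<le> 1 \<longrightarrow> \<bar>g x - poly p x\<bar> \<le> K * (bandlimited_rate 1 c N * L2_norm_real g))"
proof -
  obtain K where K: "0 \<le> K"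
    "\<And>n x. 0 < n \<Longrightarrow> \<bar>x\<bar> \<le> 1 \<Longrightarrow>
       \<bar>g x - poly (interpolant n g) x\<bar> \<le> K * (sqrt (c ^ (2 * n + 1) / real (2 * n + 1)) / (fact n * 2 ^ n))"
    using bandlimited_interpolation_error[OF g c] by blast
  obtain k :: real where k: "0 < k" "\<And>n. 0 < n \<Longrightarrow> k * sqrt (real n) * (real n / exp 1) ^ n \<le> fact n"
    using fact_ge_stirling by blast
  \<comment> \<open>\<open>sqrt (2 n + 1) >= sqrt n\<close> and the \<open>sqrt n\<close> of
    Stirling's bound combine to a full factor \<open>n\<close>, which raises the power of
    \<open>e c / (2 n)\<close> from \<open>n\<close> to \<open>n + 1 = N + 2\<close>; the
    compensating factor is \<open>2 / e\<close> times \<open>sqrt c / c\<close>.\<close>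
  have rate: "sqrt (c ^ (2 * n + 1) / real (2 * n + 1)) / (fact n * 2 ^ n) \<le> 2 / (k * exp 1) * bandlimited_rate 1 c N"
    if n: "n = N + 1" for n N
  proof -
    have np: "0 < real n" using n by simp
    have "sqrt (c ^ (2 * n + 1) / real (2 * n + 1)) = c ^ n * sqrt c / sqrt (2 * n + 1)"
      using c by (simp add: real_sqrt_divide real_sqrt_mult power_mult real_sqrt_power power_even_eq)
    then have "sqrt (c ^ (2 * n + 1) / real (2 * n + 1)) / (fact n * 2 ^ n) = c ^ n * sqrt c / (sqrt (2 * n + 1) * (fact n * 2 ^ n))"
      by simp
    also have "\<dots> \<le> c ^ n * sqrt c / (sqrt n * (k * sqrt n * (real n / exp 1) ^ n * 2 ^ n))"
      using c k np by (intro divide_left_mono mult_mono mult_right_mono mult_pos_pos) auto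
    also have "\<dots> = c ^ n * sqrt c / (k * n * (real n / exp 1) ^ n * 2 ^ n)"
      using np by (simp add: real_sqrt_mult_self mult_ac) 
    also have "\<dots> = 2 / (k * exp 1) * (sqrt c / c * (exp 1 * c / (2 * real n)) ^ (n + 1))"
      using c k np by (simp add: power_divide power_mult_distrib field_simps)
    also have "sqrt c / c = c powr (- 1 / 2)"
      using c by (simp add: powr_minus powr_half_sqrt field_simps)
    also have "c powr (- 1 / 2) * (exp 1 * c / (2 * real n)) ^ (n + 1) = bandlimited_rate 1 c N"
    proof -
      have "2 * real n = 2 * real N + 2" "n + 1 = N + 2" using n by auto
      then show ?thesis by (simp only: bandlimited_rate_def mult_1_right)
    qed
    finally show ?thesis .
  qed
  have pos: "0 \<le> bandlimited_rate 1 c N" for N using c by (simp add: bandlimited_rate_def)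
  have L: "0 \<le> L2_norm_real g" by (simp add: L2_norm_real_def)
  show thesis
  proof (cases "L2_norm_real g = 0")
    case True
    have "g x = 0" for x by (rule bandlimited_norm_zero[OF g True])
    then show ?thesis by (intro that[of 0] exI[of _ 0]) auto
  next
    case False
    with L have L: "0 < L2_norm_real g" by simp
    define K' where "K' = K * (2 / (k * exp 1)) / L2_norm_real g"
    show ?thesis
    proof (rule that[of K'])
      show "0 \<le> K'" using K k L by (simp add: K'_def)
      fix N
      show "\<exists>p. Polynomial.degree p \<le> N \<and>
        (\<forall>x. \<bar>x\<bar> \<le> 1 \<longrightarrow> \<bar>g x - poly p x\<bar> \<le> K' * (bandlimited_rate 1 c N * L2_norm_real g))"
      proof (intro exI[of _ "interpolant (N + 1) g"] conjI allI impI)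
        show "Polynomial.degree (interpolant (N + 1) g) \<le> N" using degree_interpolant[of "N + 1" g] by simp
        fix x :: real assume x: "\<bar>x\<bar> \<le> 1"
        have "\<bar>g x - poly (interpolant (N + 1) g) x\<bar> \<le> K * (2 / (k * exp 1) * bandlimited_rate 1 c N)"
          using x by (intro order_trans[OF K(2) mult_left_mono[OF rate K(1)]]) auto
        also have "\<dots> = K' * (bandlimited_rate 1 c N * L2_norm_real g)" using L by (simp add: K'_def)
        finally show "\<bar>g x - poly (interpolant (N + 1) g) x\<bar> \<le> K' * (bandlimited_rate 1 c N * L2_norm_real g)" .
      qed
    qed
  qed
qed

section \<open>Orthonormality of the ultraspherical Jacobi polynomials\<close>

lemma has_integral_ultraspherical:
  fixes a :: real assumes a: "-1 < a"
  shows "((\<lambda>x. (1 - x\<^sup>2) powr a) has_integral (2 powr (2 * a + 1) * Beta (a + 1) (a + 1))) {-1..1}"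
proof -
  have "((\<lambda>t. t powr a * (1 - t) powr a) has_integral Beta (a + 1) (a + 1)) (cbox 0 1)"
    using has_integral_Beta_real[of "a + 1" "a + 1"] a by simp
  from has_integral_affinity'[OF this, of "1 / 2" "1 / 2"]
  have "((\<lambda>x. (x / 2 + 1 / 2) powr a * (1 - (x / 2 + 1 / 2)) powr a) has_integral 2 * Beta (a + 1) (a + 1)) {-1..1}"
    by simp
  \<comment> \<open>With \<open>t = (x + 1) / 2\<close> one has
    \<open>4 t (1 - t) = 1 - x^2\<close>, hence the factor \<open>4 powr a\<close>.\<close>
  from has_integral_mult_right[OF this, of "4 powr a"]
  have "((\<lambda>x. 4 powr a * ((x / 2 + 1 / 2) powr a * (1 - (x / 2 + 1 / 2)) powr a)) has_integral 4 powr a * (2 * Beta (a + 1) (a + 1))) {-1..1}" .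
  moreover have "4 powr a * (2 * Beta (a + 1) (a + 1)) = 2 powr (2 * a + 1) * Beta (a + 1) (a + 1)"
  proof -
    have "(4::real) powr a = 2 powr (2 * a)" using powr_powr[of "2::real" 2 a] by simp
    then show ?thesis by (simp add: powr_add)
  qed
  moreover have "4 powr a * ((x / 2 + 1 / 2) powr a * (1 - (x / 2 + 1 / 2)) powr a) = (1 - x\<^sup>2) powr a"
    if "x \<in> {-1..1}" for x :: real
  proof -
    have nn: "0 \<le> x / 2 + 1 / 2" "0 \<le> 1 - (x / 2 + 1 / 2)" using that by auto
    then have "4 powr a * ((x / 2 + 1 / 2) powr a * (1 - (x / 2 + 1 / 2)) powr a) = (4 * ((x / 2 + 1 / 2) * (1 - (x / 2 + 1 / 2)))) powr a"
      using mult_nonneg_nonneg[OF nn] by (simp only: powr_mult)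
    also have "4 * ((x / 2 + 1 / 2) * (1 - (x / 2 + 1 / 2))) = 1 - x\<^sup>2"
      by (simp add: field_simps power2_eq_square)
    finally show ?thesis .
  qed
  ultimately show ?thesis by (metis (no_types, lifting) has_integral_eq)
qed

text \<open>For a nonnegative function a finite gauge integral is a finite Lebesgue integral; this
  covers weights unbounded at the end points.\<close>

lemma set_integrable_ultraspherical:
  fixes a :: real assumes a: "-1 < a"
  shows "set_integrable lborel {-1..1} (\<lambda>x. (1 - x\<^sup>2) powr a)"
proof -
  have "(\<integral>\<^sup>+x. ennreal (indicator {-1..1} x * (1 - x\<^sup>2) powr a) \<partial>lborel) = ennreal (2 powr (2 * a + 1) * Beta (a + 1) (a + 1))"
    by (rule nn_integral_has_integral_lebesgue[OF _ has_integral_ultraspherical[OF a]]) simp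
  then show ?thesis
    unfolding set_integrable_def by (intro integrableI_nonneg) (auto simp: less_top[symmetric])
qed

text \<open>A functional on polynomials, which turns orthogonality into polynomial algebra. The
  exponent is a parameter because every integration by parts raises it.\<close>

definition ultraspherical_integral :: "real \<Rightarrow> real poly \<Rightarrow> real" where
  "ultraspherical_integral a r = (LINT x:{-1..1}|lborel. poly r x * (1 - x\<^sup>2) powr a)"

lemma set_integrable_poly_ultraspherical:
  fixes a :: real assumes a: "-1 < a"
  shows "set_integrable lborel {-1..1} (\<lambda>x. poly r x * (1 - x\<^sup>2) powr a)"
proof -
  have "compact (poly r ` {-1..1})"
    by (intro compact_continuous_image continuous_intros) auto
  from compact_imp_bounded[OF this] obtain K where "\<forall>y\<in>poly r ` {-1..1}. norm y \<le> K"
    unfolding bounded_iff by blast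
  then have K: "\<And>x. x \<in> {-1..1} \<Longrightarrow> \<bar>poly r x\<bar> \<le> K" by simp
  have pm: "(\<lambda>x. poly r x) \<in> borel_measurable borel"
    by (intro borel_measurable_continuous_onI continuous_intros)
  note [measurable] = pm
  show ?thesis
    unfolding set_integrable_def
  proof (rule Bochner_Integration.integrable_bound)
    show "integrable lborel (\<lambda>x. K * (indicator {-1..1} x *\<^sub>R (1 - x\<^sup>2) powr a))"
      using set_integrable_ultraspherical[OF a] unfolding set_integrable_def by (rule integrable_mult_right)
    show "AE x in lborel. norm (indicator {-1..1} x *\<^sub>R (poly r x * (1 - x\<^sup>2) powr a)) \<le> norm (K * (indicator {-1..1} x *\<^sub>R (1 - x\<^sup>2) powr a))"
      using K by (intro AE_I2) (auto simp: indicator_def abs_mult intro!: mult_right_mono order_trans[OF K abs_ge_self])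
  qed measurable
qed

text \<open>Polynomials times powers of \<open>1 - x^2\<close> are closed under differentiation,
  with the exponent dropping by one. The polynomial factor is the recursion step of
  \<open>rodrigues\<close>.\<close>

lemma DERIV_poly_ultraspherical:
  fixes x :: real
  assumes x: "x \<in> {-1<..<1}"
  shows "((\<lambda>x. poly u x * (1 - x\<^sup>2) powr b) has_real_derivative
    poly (pderiv u * [:1, 0, -1:] - Polynomial.smult (2 * b) ([:0, 1:] * u)) x * (1 - x\<^sup>2) powr (b - 1)) (at x)"
proof -
  have pos: "0 < 1 - x\<^sup>2" using x by (simp add: abs_square_less_1 abs_less_iff)
  define W where "W = (1 - x\<^sup>2) powr (b - 1)"
  have W: "(1 - x\<^sup>2) powr b = (1 - x\<^sup>2) * W"
    using pos powr_mult_base[of "1 - x\<^sup>2" "b - 1"] by (simp add: W_def)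
  have "((\<lambda>x. 1 - x\<^sup>2) has_real_derivative (- 2 * x)) (at x)"
    by (auto intro!: derivative_eq_intros)
  from DERIV_chain2[OF has_real_derivative_powr[OF pos, of b] this]
  have "((\<lambda>x. (1 - x\<^sup>2) powr b) has_real_derivative (b * W * (- 2 * x))) (at x)"
    by (simp add: W_def)
  from DERIV_mult[OF poly_DERIV[of u x] this]
  have "((\<lambda>x. poly u x * (1 - x\<^sup>2) powr b) has_real_derivative
      (poly (pderiv u) x * (1 - x\<^sup>2) powr b + b * W * (- 2 * x) * poly u x)) (at x)" .
  moreover have "poly (pderiv u) x * (1 - x\<^sup>2) powr b + b * W * (- 2 * x) * poly u x
      = poly (pderiv u * [:1, 0, -1:] - Polynomial.smult (2 * b) ([:0, 1:] * u)) x * W"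
    unfolding W by (simp add: power2_eq_square algebra_simps)
  ultimately show ?thesis by (simp add: W_def)
qed

context
  fixes a :: real
  assumes a: "-1 < a"
begin

lemma ultraspherical_integral_add:
  "ultraspherical_integral a (p + q) = ultraspherical_integral a p + ultraspherical_integral a q"
  unfolding ultraspherical_integral_def
  by (simp add: distrib_right set_integral_add(2)[OF set_integrable_poly_ultraspherical[OF a] set_integrable_poly_ultraspherical[OF a]])

lemma ultraspherical_integral_smult:
  "ultraspherical_integral a (Polynomial.smult c p) = c * ultraspherical_integral a p"
  unfolding ultraspherical_integral_def by (simp add: mult.assoc)

lemma ultraspherical_integral_sum:
  "finite I \<Longrightarrow> ultraspherical_integral a (\<Sum>i\<in>I. p i) = (\<Sum>i\<in>I. ultraspherical_integral a (p i))"
proof (induction I rule: finite_induct)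
  case empty
  show ?case using ultraspherical_integral_smult[of 0 0] by simp
qed (simp add: ultraspherical_integral_add)

lemma ultraspherical_integral_const:
  "ultraspherical_integral a [:c:] = c * (2 powr (2 * a + 1) * Beta (a + 1) (a + 1))"
proof -
  have "ultraspherical_integral a 1 = integral {-1..1} (\<lambda>x. (1 - x\<^sup>2) powr a)"
    unfolding ultraspherical_integral_def
    using set_borel_integral_eq_integral(2)[OF set_integrable_ultraspherical[OF a]] by simp
  also have "\<dots> = 2 powr (2 * a + 1) * Beta (a + 1) (a + 1)"
    using has_integral_ultraspherical[OF a] by (rule integral_unique)
  finally show ?thesis using ultraspherical_integral_smult[of c 1] by (simp add: one_pCons)
qed

lemma ultraspherical_integral_shift:
  "ultraspherical_integral a (u * [:1, 0, -1:]) = ultraspherical_integral (a + 1) u"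
  unfolding ultraspherical_integral_def
proof (rule set_lebesgue_integral_cong)
  show "\<forall>x. x \<in> {-1..1} \<longrightarrow> poly (u * [:1, 0, -1:]) x * (1 - x\<^sup>2) powr a = poly u x * (1 - x\<^sup>2) powr (a + 1)"
  proof (intro allI impI)
    fix x :: real assume "x \<in> {-1..1}"
    then have "0 \<le> 1 - x\<^sup>2" by (simp add: abs_square_le_1 abs_le_iff)
    \<comment> \<open>At the end points both sides are 0 by the convention
      \<open>0 powr a = 0\<close>.\<close>
    then have "(1 - x\<^sup>2) powr (a + 1) = (1 - x\<^sup>2) * (1 - x\<^sup>2) powr a"
      by (cases "1 - x\<^sup>2 = 0") (auto simp: powr_add)
    moreover have "poly (u * [:1, 0, -1:]) x = poly u x * (1 - x\<^sup>2)"
      by (simp add: power2_eq_square algebra_simps)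
    ultimately show "poly (u * [:1, 0, -1:]) x * (1 - x\<^sup>2) powr a = poly u x * (1 - x\<^sup>2) powr (a + 1)"
      by (simp only: mult.assoc)
  qed
qed simp

text \<open>The integrand is the derivative of \<open>u (1 - x\<^sup>2)\<^bsup>a+1\<^esup>\<close>, which vanishes at both end points.\<close>

lemma ultraspherical_integral_derivative:
  "ultraspherical_integral a (pderiv u * [:1, 0, -1:] - Polynomial.smult (2 * (a + 1)) ([:0, 1:] * u)) = 0"
    (is "ultraspherical_integral a ?p = 0")
proof -
  define f where "f x = poly u x * (1 - x\<^sup>2) powr (a + 1)" for x
  have nn: "0 \<le> 1 - x\<^sup>2" if "x \<in> {-1..1}" for x :: real
    using that by (simp add: abs_square_le_1 abs_le_iff)
  have "((\<lambda>x. poly ?p x * (1 - x\<^sup>2) powr a) has_integral (f 1 - f (-1))) {-1..1}"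
  \<comment> \<open>For \<open>a < 0\<close> the integrand may be unbounded at the end points, but
    \<open>f\<close> is continuous up to them because \<open>a + 1 > 0\<close>.\<close>
  proof (rule fundamental_theorem_of_calculus_interior)
    show "continuous_on {-1..1} f"
      unfolding f_def using a nn by (intro continuous_intros continuous_on_powr') auto
    fix x :: real assume x: "x \<in> {-1<..<1}"
    then have "(f has_real_derivative (poly ?p x * (1 - x\<^sup>2) powr a)) (at x)"
      unfolding f_def using DERIV_poly_ultraspherical[of x u "a + 1"] by simp
    then show "(f has_vector_derivative (poly ?p x * (1 - x\<^sup>2) powr a)) (at x)"
      by (simp add: has_real_derivative_iff_has_vector_derivative)
  qed simp
  then show ?thesis
    unfolding ultraspherical_integral_def
    by (subst set_borel_integral_eq_integral(2)[OF set_integrable_poly_ultraspherical[OF a]])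
      (simp add: integral_unique f_def)
qed

end

text \<open>Differentiating \<open>(1 - x\<^sup>2)\<^bsup>s\<^esup>\<close> \<open>j\<close> times gives \<open>rodrigues s j\<close> times \<open>(1 - x\<^sup>2)\<^bsup>s-j\<^esup>\<close>.\<close>

primrec rodrigues :: "real \<Rightarrow> nat \<Rightarrow> real poly" where
  "rodrigues s 0 = 1"
| "rodrigues s (Suc j) = pderiv (rodrigues s j) * [:1, 0, -1:] - Polynomial.smult (2 * (s - real j)) ([:0, 1:] * rodrigues s j)"

lemma rodrigues_degree:
  "Polynomial.degree (rodrigues s j) \<le> j"
proof (induction j)
  case (Suc j)
  have "Polynomial.degree (pderiv (rodrigues s j) * [:1, 0, -1:]) \<le> Suc j"
  proof (cases "pderiv (rodrigues s j) = 0")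
    case False
    then have "Polynomial.degree (rodrigues s j) \<noteq> 0" by (simp add: pderiv_eq_0_iff)
    then show ?thesis
      using Suc order_trans[OF degree_mult_le, of "pderiv (rodrigues s j)" "[:1, 0, -1:]" "Suc j"]
      by (simp add: degree_pderiv)
  qed simp
  moreover have "Polynomial.degree (Polynomial.smult (2 * (s - real j)) ([:0, 1:] * rodrigues s j)) \<le> Suc j"
    using Suc by (intro order_trans[OF degree_smult_le] order_trans[OF degree_mult_le]) auto
  ultimately show ?case unfolding rodrigues.simps by (rule degree_diff_le)
qed simp

text \<open>The derivative times \<open>- x^2\<close> contributes \<open>- j\<close>, the other term
  \<open>- 2 (s - j)\<close>.\<close>

lemma rodrigues_lead_coeff:
  "coeff (rodrigues s (Suc j)) (Suc j) = - (2 * s - real j) * coeff (rodrigues s j) j"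
proof -
  have "coeff (pderiv (rodrigues s j) * [:1, 0, -1:]) (Suc j) = - real j * coeff (rodrigues s j) j"
  proof -
    have 0: "coeff (rodrigues s j) i = 0" if "i > j" for i
      using that rodrigues_degree[of s j] by (intro coeff_eq_0) auto
    have "pderiv (rodrigues s j) * [:1, 0, -1:] = pderiv (rodrigues s j) - pCons 0 (pCons 0 (pderiv (rodrigues s j)))"
      by (simp add: mult.commute[of _ "[:1, 0, -1:]"])
    then show ?thesis
      using 0[of "Suc (Suc j)"] by (cases j) (simp_all add: coeff_pderiv algebra_simps del: rodrigues.simps)
  qed
  then show ?thesis by (simp add: algebra_simps)
qed

text \<open>Agreement of \<open>h\<close> with the power is asked only inside the interval; since it
  is open, derivatives there depend on nothing else.\<close>

lemma iterated_deriv_ultraspherical: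
  assumes x: "x \<in> {-1<..<1}"
    and h: "\<And>t. t \<in> {-1<..<1} \<Longrightarrow> h t = (1 - t\<^sup>2) powr s"
  shows "(deriv ^^ j) h x = poly (rodrigues s j) x * (1 - x\<^sup>2) powr (s - real j)"
  using x
proof (induction j arbitrary: x)
  case 0
  then show ?case by (simp add: h)
next
  case (Suc j)
  let ?f = "\<lambda>t. poly (rodrigues s j) t * (1 - t\<^sup>2) powr (s - real j)"
  have "(?f has_real_derivative (poly (rodrigues s (Suc j)) x * (1 - x\<^sup>2) powr (s - real j - 1))) (at x)"
    using DERIV_poly_ultraspherical[OF Suc.prems, of "rodrigues s j" "s - real j"] by simp
  moreover have "\<forall>\<^sub>F t in nhds x. (deriv ^^ j) h t = ?f t"
    using eventually_nhds_in_open[of "{-1<..<1}" x] Suc.prems Suc.IH by (auto elim: eventually_mono)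
  ultimately have "((deriv ^^ j) h has_real_derivative (poly (rodrigues s (Suc j)) x * (1 - x\<^sup>2) powr (s - real j - 1))) (at x)"
    by (subst DERIV_cong_ev[OF refl _ refl])
  then show ?case by (simp add: DERIV_imp_deriv algebra_simps)
qed

text \<open>The vanishing integral of a derivative, applied to \<open>r * rodrigues s i\<close>: the
  product rule yields \<open>rodrigues s (Suc i)\<close> when the derivative falls on the other
  factors, and \<open>pderiv r\<close> with the exponent raised by one. The hypothesis keeps the
  lower exponent above -1.\<close>

lemma ultraspherical_integral_by_parts:
  assumes "real i - s < 0"
  shows "ultraspherical_integral (s - real (Suc i)) (r * rodrigues s (Suc i)) =
    - ultraspherical_integral (s - real i) (pderiv r * rodrigues s i)"
proof -
  define b where "b = s - real (Suc i)"
  have b: "-1 < b" "b + 1 = s - real i" using assms by (auto simp: b_def)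
  have "pderiv (r * rodrigues s i) * [:1, 0, -1:] - Polynomial.smult (2 * (b + 1)) ([:0, 1:] * (r * rodrigues s i))
      = r * rodrigues s (Suc i) + (pderiv r * rodrigues s i) * [:1, 0, -1:]"
    unfolding b(2) by (simp add: pderiv_mult algebra_simps)
  with ultraspherical_integral_derivative[OF b(1), of "r * rodrigues s i"]
  have "ultraspherical_integral b (r * rodrigues s (Suc i) + (pderiv r * rodrigues s i) * [:1, 0, -1:]) = 0"
    by (simp only:)
  then have "ultraspherical_integral b (r * rodrigues s (Suc i)) + ultraspherical_integral (b + 1) (pderiv r * rodrigues s i) = 0"
    unfolding ultraspherical_integral_add[OF b(1)] ultraspherical_integral_shift[OF b(1)] .
  then show ?thesis using b(2) by (simp add: b_def)
qed

context
  fixes \<alpha> :: real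
  assumes \<alpha>: "- 1 / 2 \<le> \<alpha>"
begin

lemma ultraspherical_integral_rodrigues:
  "ultraspherical_integral \<alpha> (r * rodrigues (\<alpha> + real k) k) =
     (-1) ^ k * ultraspherical_integral (\<alpha> + real k) ((pderiv ^^ k) r)"
proof -
  have "ultraspherical_integral \<alpha> (r * rodrigues (\<alpha> + real k) k) =
     (-1) ^ j * ultraspherical_integral (\<alpha> + real j) ((pderiv ^^ j) r * rodrigues (\<alpha> + real k) (k - j))"
    if "j \<le> k" for j
    using that
  proof (induction j)
    case (Suc j)
    then obtain i where i: "k - j = Suc i" "k - Suc j = i" by (metis Suc_diff_Suc Suc_le_lessD)
    have e: "\<alpha> + real j = \<alpha> + real k - real (Suc i)" "\<alpha> + real (Suc j) = \<alpha> + real k - real i"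
      using i Suc.prems by linarith+
    have "real i - (\<alpha> + real k) < 0" using i \<alpha> by linarith
    from ultraspherical_integral_by_parts[OF this, of "(pderiv ^^ j) r"]
    show ?case using Suc unfolding i e by simp
  qed simp
  from this[of k] show ?thesis by simp
qed

text \<open>Multiplied by the Gamma value, the recursion factor \<open>z\<close> is absorbed by
  \<open>Gamma (z + 1) = z * Gamma z\<close>; \<open>j < k\<close> keeps \<open>z\<close> positive
  in each step.\<close>

lemma rodrigues_lead_coeff_Gamma:
  assumes "j \<le> k"
  shows "coeff (rodrigues (\<alpha> + real k) j) j * Gamma (2 * real k + 2 * \<alpha> - real j + 1) = (-1) ^ j * Gamma (2 * real k + 2 * \<alpha> + 1)"
  using assms
proof (induction j)
  case (Suc j)
  define z where "z = 2 * real k + 2 * \<alpha> - real j"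
  have "real j + 1 \<le> real k" using Suc.prems by linarith
  then have "0 < z" using \<alpha> by (simp add: z_def)
  then have G: "Gamma (z + 1) = z * Gamma z"
    by (intro Gamma_plus1) (auto elim!: nonpos_Ints_cases)
  have "coeff (rodrigues (\<alpha> + real k) (Suc j)) (Suc j) * Gamma (2 * real k + 2 * \<alpha> - real (Suc j) + 1)
      = - z * coeff (rodrigues (\<alpha> + real k) j) j * Gamma z"
    unfolding rodrigues_lead_coeff by (simp add: z_def algebra_simps)
  also have "\<dots> = - (coeff (rodrigues (\<alpha> + real k) j) j * Gamma (z + 1))" by (simp add: G)
  also have "\<dots> = - ((-1) ^ j * Gamma (2 * real k + 2 * \<alpha> + 1))"
    using Suc unfolding z_def by simp
  finally show ?case by simp
qed simp

section \<open>Jacobi polynomials as an orthonormal basis\<close>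

definition jacobi_poly :: "nat \<Rightarrow> real poly" where
  "jacobi_poly k = Polynomial.smult ((-1) ^ k / (2 ^ k * fact k)) (rodrigues (\<alpha> + real k) k)"

text \<open>Starting from the exponent \<open>\<alpha> + k\<close>, \<open>k\<close> derivatives
  leave exactly the weight that the prefactor in Rodrigues' formula cancels.\<close>

lemma jacobi_eq_poly:
  assumes x: "x \<in> {-1<..<1}"
  shows "jacobi \<alpha> \<alpha> k x = poly (jacobi_poly k) x"
proof -
  have w: "jacobi_weight \<alpha> \<alpha> t = (1 - t\<^sup>2) powr \<alpha>" if "t \<in> {-1<..<1}" for t
    using that unfolding jacobi_weight_def by (subst powr_mult[symmetric]) (auto simp: power2_eq_square algebra_simps)
  have "(deriv ^^ k) (\<lambda>t. jacobi_weight \<alpha> \<alpha> t * (1 - t\<^sup>2) ^ k) x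
      = poly (rodrigues (\<alpha> + real k) k) x * (1 - x\<^sup>2) powr (\<alpha> + real k - real k)"
  proof (rule iterated_deriv_ultraspherical[OF x])
    fix t :: real assume t: "t \<in> {-1<..<1}"
    then have "0 < 1 - t\<^sup>2" by (simp add: abs_square_less_1 abs_less_iff)
    then show "jacobi_weight \<alpha> \<alpha> t * (1 - t\<^sup>2) ^ k = (1 - t\<^sup>2) powr (\<alpha> + real k)"
      by (simp add: w[OF t] powr_add powr_realpow)
  qed
  moreover have "0 < 1 - x\<^sup>2" using x by (simp add: abs_square_less_1 abs_less_iff)
  ultimately show ?thesis unfolding jacobi_def w[OF x] by (simp add: jacobi_poly_def)
qed

lemma jacobi_poly_degree: "Polynomial.degree (jacobi_poly k) \<le> k"
  unfolding jacobi_poly_def by (rule order_trans[OF degree_smult_le rodrigues_degree])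

text \<open>After \<open>k\<close> integrations by parts only the constant \<open>k!\<close> times
  the top coefficient of \<open>r\<close> is left. The formula contains orthogonality, where that
  coefficient is 0, as well as the norm.\<close>

lemma ultraspherical_integral_jacobi_poly:
  assumes "Polynomial.degree r \<le> k"
  shows "ultraspherical_integral \<alpha> (r * jacobi_poly k) =
    coeff r k / 2 ^ k * (2 powr (2 * (\<alpha> + real k) + 1) * Beta (\<alpha> + real k + 1) (\<alpha> + real k + 1))"
proof -
  have a: "-1 < \<alpha>" "-1 < \<alpha> + real k" using \<alpha> by auto
  have "(pderiv ^^ k) r = [:fact k * coeff r k:]"
  proof (rule poly_eqI)
    fix i
    show "coeff ((pderiv ^^ k) r) i = coeff [:fact k * coeff r k:] i"
      using assms by (cases i) (simp_all add: coeff_higher_pderiv pochhammer_fact[symmetric] coeff_eq_0)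
  qed
  then have "ultraspherical_integral \<alpha> (r * rodrigues (\<alpha> + real k) k) =
     (-1) ^ k * (fact k * coeff r k * (2 powr (2 * (\<alpha> + real k) + 1) * Beta (\<alpha> + real k + 1) (\<alpha> + real k + 1)))"
    unfolding ultraspherical_integral_rodrigues using ultraspherical_integral_const[OF a(2)] by simp
  then show ?thesis
    unfolding jacobi_poly_def mult_smult_right ultraspherical_integral_smult[OF a(1)]
    by (simp add: power_mult_distrib[symmetric])
qed

lemma jacobi_h_pos: "0 < jacobi_h \<alpha> \<alpha> k"
  unfolding jacobi_h_def using \<alpha>
  by (auto intro!: divide_pos_pos mult_pos_pos Gamma_real_pos)

lemma jacobi_poly_norm:
  "ultraspherical_integral \<alpha> (jacobi_poly k * jacobi_poly k) = jacobi_h \<alpha> \<alpha> k"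
proof (cases "k = 0")
  case True
  have "ultraspherical_integral \<alpha> (jacobi_poly 0 * jacobi_poly 0) = ultraspherical_integral \<alpha> [:1:]"
    by (simp add: jacobi_poly_def one_pCons)
  also have "\<dots> = jacobi_h \<alpha> \<alpha> 0"
    using \<alpha> ultraspherical_integral_const[of \<alpha> 1] by (simp add: jacobi_h_def Beta_def algebra_simps)
  finally show ?thesis using True by simp
next
  case False
  define G where "G = Gamma (real k + 2 * \<alpha> + 1)"
  define H where "H = Gamma (2 * real k + 2 * \<alpha> + 1)"
  \<comment> \<open>For \<open>k = 0\<close> and \<open>\<alpha> = -1/2\<close> the argument of
    \<open>G\<close> is 0, a pole of Gamma, hence the separate case above.\<close>
  have k1: "1 \<le> real k" using False by simp
  have G: "0 < G" unfolding G_def using \<alpha> k1 by (intro Gamma_real_pos) linarith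
  have H: "0 < H" unfolding H_def using \<alpha> k1 by (intro Gamma_real_pos) linarith
  have "coeff (rodrigues (\<alpha> + real k) k) k * G = (-1) ^ k * H"
    using rodrigues_lead_coeff_Gamma[of k k] by (simp add: G_def H_def)
  then have "coeff (rodrigues (\<alpha> + real k) k) k = (-1) ^ k * H / G" using G by (simp add: field_simps)
  then have c: "coeff (jacobi_poly k) k = H / (G * (2 ^ k * fact k))"
    by (simp add: jacobi_poly_def power_mult_distrib[symmetric])
  have z: "0 < 2 * real k + 2 * \<alpha> + 1" using \<alpha> k1 by linarith
  have "Gamma (2 * real k + 2 * \<alpha> + 1 + 1) = (2 * real k + 2 * \<alpha> + 1) * H"
    unfolding H_def using z by (intro Gamma_plus1) (auto elim!: nonpos_Ints_cases)
  then have B: "Beta (\<alpha> + real k + 1) (\<alpha> + real k + 1) = (Gamma (real k + \<alpha> + 1))\<^sup>2 / ((2 * real k + 2 * \<alpha> + 1) * H)"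
    by (simp add: Beta_def power2_eq_square add_ac)
  have p: "2 powr (2 * (\<alpha> + real k) + 1) = 2 powr (\<alpha> + \<alpha> + 1) * (2 ^ k * 2 ^ k)"
  proof -
    have "2 * (\<alpha> + real k) + 1 = (\<alpha> + \<alpha> + 1) + real (k + k)" by simp
    then show ?thesis by (simp only: powr_add powr_realpow zero_less_numeral power_add)
  qed
  have h: "jacobi_h \<alpha> \<alpha> k = 2 powr (\<alpha> + \<alpha> + 1) * (Gamma (real k + \<alpha> + 1))\<^sup>2 / (fact k * (2 * real k + 2 * \<alpha> + 1) * G)"
    using False by (simp add: jacobi_h_def G_def power2_eq_square algebra_simps)
  show ?thesis
    unfolding ultraspherical_integral_jacobi_poly[OF jacobi_poly_degree] c B p h
    using G H z by (simp add: divide_simps)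
qed

definition jacobi_onb :: "nat \<Rightarrow> real poly" where
  "jacobi_onb k = Polynomial.smult (1 / sqrt (jacobi_h \<alpha> \<alpha> k)) (jacobi_poly k)"

lemma jacobi_normalized_eq_poly:
  "x \<in> {-1<..<1} \<Longrightarrow> jacobi_normalized \<alpha> \<alpha> k x = poly (jacobi_onb k) x"
  by (simp add: jacobi_normalized_def jacobi_onb_def jacobi_eq_poly)

text \<open>The squared norm is a multiple of this coefficient and is positive.\<close>

lemma jacobi_poly_lead_coeff: "coeff (jacobi_poly k) k \<noteq> 0"
proof
  assume "coeff (jacobi_poly k) k = 0"
  then have "jacobi_h \<alpha> \<alpha> k = 0"
    using jacobi_poly_norm[of k] ultraspherical_integral_jacobi_poly[OF jacobi_poly_degree, of k] by simp
  then show False using jacobi_h_pos[of k] by simp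
qed

lemma jacobi_onb_orthonormal:
  "ultraspherical_integral \<alpha> (jacobi_onb i * jacobi_onb j) = (if i = j then 1 else 0)"
proof -
  have a: "-1 < \<alpha>" using \<alpha> by simp
  have orth: "ultraspherical_integral \<alpha> (jacobi_poly i * jacobi_poly j) = 0" if "i < j" for i j
    using that jacobi_poly_degree[of i] by (subst ultraspherical_integral_jacobi_poly) (auto simp: coeff_eq_0)
  have "ultraspherical_integral \<alpha> (jacobi_poly i * jacobi_poly j) = 0" if "i \<noteq> j"
    using that orth[of i j] orth[of j i] by (cases i j rule: linorder_cases) (auto simp: mult.commute)
  moreover have "ultraspherical_integral \<alpha> (jacobi_onb i * jacobi_onb j) =
      1 / sqrt (jacobi_h \<alpha> \<alpha> i) * (1 / sqrt (jacobi_h \<alpha> \<alpha> j) * ultraspherical_integral \<alpha> (jacobi_poly i * jacobi_poly j))"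
    unfolding jacobi_onb_def mult_smult_left mult_smult_right ultraspherical_integral_smult[OF a] by simp
  ultimately show ?thesis using jacobi_h_pos[of i] by (auto simp: jacobi_poly_norm)
qed

lemma jacobi_onb_span:
  assumes "Polynomial.degree p \<le> N"
  shows "\<exists>d. p = (\<Sum>k\<le>N. Polynomial.smult (d k) (jacobi_onb k))"
  using assms
proof (induction N arbitrary: p)
  case 0
  have d0: "Polynomial.degree (jacobi_onb 0) = 0" "coeff (jacobi_onb 0) 0 \<noteq> 0"
    using jacobi_poly_degree[of 0] jacobi_poly_lead_coeff[of 0] jacobi_h_pos[of 0] by (auto simp: jacobi_onb_def)
  obtain a where a: "p = [:a:]" using 0 by (auto elim: degree_eq_zeroE)
  obtain b where b: "jacobi_onb 0 = [:b:]" using d0(1) by (auto elim: degree_eq_zeroE)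
  show ?case using d0(2) by (intro exI[of _ "\<lambda>_. a / b"]) (simp add: a b)
next
  case (Suc N)
  define c where "c = coeff p (Suc N) / coeff (jacobi_onb (Suc N)) (Suc N)"
  have c0: "coeff (jacobi_onb (Suc N)) (Suc N) \<noteq> 0"
    using jacobi_poly_lead_coeff[of "Suc N"] jacobi_h_pos[of "Suc N"] by (simp add: jacobi_onb_def)
  have dj: "Polynomial.degree (jacobi_onb (Suc N)) \<le> Suc N"
    unfolding jacobi_onb_def by (rule order_trans[OF degree_smult_le jacobi_poly_degree])
  define q where "q = p - Polynomial.smult c (jacobi_onb (Suc N))"
  have "Polynomial.degree q \<le> N"
  proof (rule degree_le, intro allI impI)
    fix i assume "N < i"
    show "coeff q i = 0"
    proof (cases "i = Suc N")
      case True
      then show ?thesis using c0 by (simp add: q_def c_def)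
    next
      case False
      then show ?thesis using \<open>N < i\<close> dj Suc.prems by (simp add: q_def coeff_eq_0)
    qed
  qed
  from Suc.IH[OF this] obtain d where d: "q = (\<Sum>k\<le>N. Polynomial.smult (d k) (jacobi_onb k))" by blast
  have "p = q + Polynomial.smult c (jacobi_onb (Suc N))" by (simp add: q_def)
  then show ?case by (intro exI[of _ "d(Suc N := c)"]) (simp add: d)
qed

end

section \<open>The least squares estimator\<close>

context
  fixes \<alpha> :: real
  assumes \<alpha>: "- 1 / 2 \<le> \<alpha>"
begin

lemma jacobi_weight_ultraspherical:
  "x \<in> {-1..1} \<Longrightarrow> jacobi_weight \<alpha> \<alpha> x = (1 - x\<^sup>2) powr \<alpha>"
  unfolding jacobi_weight_def by (subst powr_mult[symmetric]) (auto simp: power2_eq_square algebra_simps)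

lemma gamma_const_eq: "gamma_const \<alpha> \<alpha> = jacobi_h \<alpha> \<alpha> 0"
  using \<alpha> by (simp add: gamma_const_def jacobi_h_def Beta_def algebra_simps)

lemma gamma_const_pos: "0 < gamma_const \<alpha> \<alpha>"
  unfolding gamma_const_eq by (rule jacobi_h_pos[OF \<alpha>])

text \<open>Since \<open>0 powr \<alpha> = 0\<close> for every \<open>\<alpha>\<close>, the integrand of the weighted norm vanishes at the end
  points, so only the values on the open interval matter.\<close>

lemma weighted_norm_le:
  assumes f: "\<And>x. x \<in> {-1<..<1} \<Longrightarrow> \<bar>f x - poly u x\<bar> \<le> E"
  shows "(weighted_norm \<alpha> \<alpha> f)\<^sup>2 \<le> 2 * E\<^sup>2 * gamma_const \<alpha> \<alpha> + 2 * ultraspherical_integral \<alpha> (u * u)"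
proof -
  have a: "-1 < \<alpha>" using \<alpha> by simp
  \<comment> \<open>From \<open>f^2 <= 2 (f - u)^2 + 2 u^2\<close>, which amounts to
    \<open>(f - 2 u)^2 >= 0\<close>. Integrability is then a matter of the polynomial
    majorant.\<close>
  define v where "v = [:2 * E\<^sup>2:] + Polynomial.smult 2 (u * u)"
  have "(LINT x:{-1..1}|lborel. \<bar>f x\<bar>\<^sup>2 * jacobi_weight \<alpha> \<alpha> x) \<le> ultraspherical_integral \<alpha> v"
    unfolding ultraspherical_integral_def set_lebesgue_integral_def
  proof (rule integral_mono')
    show "integrable lborel (\<lambda>x. indicator {-1..1} x *\<^sub>R (poly v x * (1 - x\<^sup>2) powr \<alpha>))"
      using set_integrable_poly_ultraspherical[OF a] unfolding set_integrable_def .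
    fix x :: real
    have v: "poly v x = 2 * E\<^sup>2 + 2 * (poly u x)\<^sup>2" by (simp add: v_def power2_eq_square)
    then show "0 \<le> indicator {-1..1} x *\<^sub>R (poly v x * (1 - x\<^sup>2) powr \<alpha>)" by simp
    show "indicator {-1..1} x *\<^sub>R (\<bar>f x\<bar>\<^sup>2 * jacobi_weight \<alpha> \<alpha> x) \<le> indicator {-1..1} x *\<^sub>R (poly v x * (1 - x\<^sup>2) powr \<alpha>)"
    proof (cases "x \<in> {-1<..<1}")
      case True
      have "\<bar>f x - poly u x\<bar>\<^sup>2 \<le> E\<^sup>2" using f[OF True] by (intro power_mono) auto
      moreover have "0 \<le> (f x - 2 * poly u x)\<^sup>2" by simp
      ultimately have "\<bar>f x\<bar>\<^sup>2 \<le> poly v x" unfolding v by (simp add: power2_eq_square algebra_simps)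
      then show ?thesis using True by (auto simp: jacobi_weight_ultraspherical intro!: mult_right_mono)
    next
      case False
      then show ?thesis by (cases "x = 1 \<or> x = -1") (auto simp: jacobi_weight_def indicator_def)
    qed
  qed
  also have "ultraspherical_integral \<alpha> v = 2 * E\<^sup>2 * gamma_const \<alpha> \<alpha> + 2 * ultraspherical_integral \<alpha> (u * u)"
    unfolding v_def ultraspherical_integral_add[OF a] ultraspherical_integral_smult[OF a] ultraspherical_integral_const[OF a]
    by (simp add: gamma_const_def)
  finally have le: "(LINT x:{-1..1}|lborel. \<bar>f x\<bar>\<^sup>2 * jacobi_weight \<alpha> \<alpha> x) \<le> \<dots>" .
  have "0 \<le> (LINT x:{-1..1}|lborel. \<bar>f x\<bar>\<^sup>2 * jacobi_weight \<alpha> \<alpha> x)"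
    unfolding set_lebesgue_integral_def by (intro integral_nonneg_AE) (auto simp: jacobi_weight_def)
  with le show ?thesis by (simp add: weighted_norm_def)
qed

lemma parseval_jacobi_onb:
  "ultraspherical_integral \<alpha> ((\<Sum>k\<le>N. Polynomial.smult (d k) (jacobi_onb \<alpha> k)) * (\<Sum>k\<le>N. Polynomial.smult (d k) (jacobi_onb \<alpha> k)))
    = (\<Sum>k\<le>N. (d k)\<^sup>2)"
proof -
  have a: "-1 < \<alpha>" using \<alpha> by simp
  show ?thesis
    unfolding sum_product mult_smult_left mult_smult_right
    by (simp add: ultraspherical_integral_sum[OF a] ultraspherical_integral_smult[OF a]
        jacobi_onb_orthonormal[OF \<alpha>] power2_eq_square if_distrib cong: if_cong)
qed

lemma least_squares_estimator_error:
  fixes x y :: "nat \<Rightarrow> real"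
  assumes n: "0 < n" and x: "\<And>j. j \<in> {1..n} \<Longrightarrow> x j \<in> {-1<..<1}"
    and p: "Polynomial.degree p \<le> N" "\<And>t. t \<in> {-1..1} \<Longrightarrow> \<bar>f t - poly p t\<bar> \<le> E"
    and y: "\<And>j. j \<in> {1..n} \<Longrightarrow> \<bar>y j - f (x j)\<bar> \<le> e"
    and inv: "invertible_mat (gram_matrix \<alpha> \<alpha> n N x)"
  defines "\<kappa> \<equiv> Max (Collect (eigenvalue (gram_matrix \<alpha> \<alpha> n N x))) / Min (Collect (eigenvalue (gram_matrix \<alpha> \<alpha> n N x)))"
  shows "0 < \<kappa>"
    and "weighted_norm \<alpha> \<alpha> (\<lambda>t. f t - ls_estimator \<alpha> \<alpha> n N x y t)
      \<le> sqrt (2 * gamma_const \<alpha> \<alpha>) * E + sqrt (gamma_const \<alpha> \<alpha>) * sqrt (2 * \<kappa>) * (E + e)"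
proof -
  define \<gamma> where "\<gamma> = gamma_const \<alpha> \<alpha>"
  have \<gamma>: "0 < \<gamma>" unfolding \<gamma>_def by (rule gamma_const_pos)
  define B where "B = design_matrix \<alpha> \<alpha> n N x"
  define A where "A = gram_matrix \<alpha> \<alpha> n N x"
  have B: "B \<in> carrier_mat n (N + 1)" by (simp add: B_def design_matrix_def)
  have AB: "A = B\<^sup>T * B" by (simp add: A_def B_def gram_matrix_def)
  have inv: "invertible_mat A" using inv by (simp add: A_def)
  have A: "A \<in> carrier_mat (N + 1) (N + 1)" by (rule gram_carrier[OF B AB])
  define mn mx where "mn = Min (Collect (eigenvalue A))" and "mx = Max (Collect (eigenvalue A))"
  have Bj: "B $$ (j, k) = 1 / sqrt n * poly (jacobi_onb \<alpha> k) (x (j + 1))" if "j < n" "k < N + 1" for j k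
    using that x[of "j + 1"] by (simp add: B_def design_matrix_def jacobi_normalized_eq_poly[OF \<alpha>])
  have mn: "0 < mn"
  proof -
    have "mn \<in> Collect (eigenvalue A)"
      unfolding mn_def using finite_eigenvalues[OF A] Min_eigenvalue_le_rayleigh(1)[OF A gram_symmetric[OF B AB]]
      by (intro Min_in) auto
    then show ?thesis using gram_eigenvalue_pos[OF B AB inv] by simp
  qed
  have mx: "1 / \<gamma> \<le> mx"
  proof -
    have "jacobi_onb \<alpha> 0 = [:1 / sqrt \<gamma>:]"
      by (simp add: jacobi_onb_def[OF \<alpha>] jacobi_poly_def[OF \<alpha>] \<gamma>_def gamma_const_eq one_pCons)
    then have "A $$ (0, 0) = (\<Sum>j<n. 1 / sqrt n * (1 / sqrt \<gamma>) * (1 / sqrt n * (1 / sqrt \<gamma>)))"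
      unfolding AB using B by (simp add: scalar_prod_def Bj atLeast0LessThan)
    also have "\<dots> = 1 / \<gamma>" using n \<gamma> by (simp add: field_simps)
    finally show ?thesis unfolding mx_def using gram_first_entry_le_Max_eigenvalue[OF B AB] by simp
  qed
  have \<kappa>: "\<kappa> = mx / mn" by (simp add: \<kappa>_def mx_def mn_def A_def)
  have mx0: "0 < mx" using mx \<gamma> by (meson less_le_trans zero_less_divide_1_iff)
  then show \<kappa>0: "0 < \<kappa>" using mn by (simp add: \<kappa>)
  obtain d where d: "p = (\<Sum>k\<le>N. Polynomial.smult (d k) (jacobi_onb \<alpha> k))"
    using jacobi_onb_span[OF \<alpha> p(1)] by blast
  define D where "D = Matrix.vec (N + 1) d"
  define z where "z = Matrix.vec n (\<lambda>j. 1 / sqrt (real n) * y (j + 1))"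
  define c where "c = ls_coeffs \<alpha> \<alpha> n N x y"
  have D: "D \<in> carrier_vec (N + 1)" and z: "z \<in> carrier_vec n" by (auto simp: D_def z_def)
  have c: "c = (the (mat_inverse A) * B\<^sup>T) *\<^sub>v z" by (simp add: c_def ls_coeffs_def A_def B_def z_def)
  have cc: "c \<in> carrier_vec (N + 1)" and ls: "mn * ((c - D) \<bullet> (c - D)) \<le> (z - B *\<^sub>v D) \<bullet> (z - B *\<^sub>v D)"
    unfolding c mn_def using least_squares_error[OF B AB inv z D] by auto
  have E0: "0 \<le> E" using p(2)[of 0] by simp
  have e0: "0 \<le> e" using y[of 1] n by fastforce
  \<comment> \<open>The factors \<open>1 / sqrt n\<close> in \<open>B\<close> and \<open>z\<close>
    turn this into a mean of \<open>n\<close> squared residuals, each residual being at most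
    \<open>E + e\<close> in absolute value.\<close>
  have "(z - B *\<^sub>v D) \<bullet> (z - B *\<^sub>v D) \<le> (E + e)\<^sup>2"
  proof -
    have r: "(z - B *\<^sub>v D) $ j = 1 / sqrt n * (y (j + 1) - poly p (x (j + 1)))" if j: "j < n" for j
    proof -
      have "(B *\<^sub>v D) $ j = (\<Sum>k<N + 1. B $$ (j, k) * d k)"
        using j B by (simp add: scalar_prod_def D_def atLeast0LessThan)
      also have "\<dots> = (\<Sum>k<N + 1. 1 / sqrt n * (d k * poly (jacobi_onb \<alpha> k) (x (j + 1))))"
        using j by (intro sum.cong) (auto simp: Bj)
      also have "\<dots> = 1 / sqrt n * poly p (x (j + 1))"
        unfolding d poly_sum sum_distrib_left[symmetric] by (simp add: lessThan_Suc_atMost)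
      finally show ?thesis using j B by (simp add: z_def right_diff_distrib diff_divide_distrib)
    qed
    have b: "(y (j + 1) - poly p (x (j + 1)))\<^sup>2 \<le> (E + e)\<^sup>2" if j: "j < n" for j
    proof -
      have "x (j + 1) \<in> {-1..1}" using x[of "j + 1"] j by auto
      then have "\<bar>y (j + 1) - poly p (x (j + 1))\<bar> \<le> E + e"
        using p(2)[of "x (j + 1)"] y[of "j + 1"] j by auto
      then show ?thesis by (metis abs_ge_zero power2_abs power_mono)
    qed
    have "(z - B *\<^sub>v D) \<bullet> (z - B *\<^sub>v D) = (\<Sum>j<n. ((z - B *\<^sub>v D) $ j)\<^sup>2)"
      using B by (simp add: scalar_prod_def power2_eq_square atLeast0LessThan)
    also have "\<dots> = (\<Sum>j<n. 1 / n * (y (j + 1) - poly p (x (j + 1)))\<^sup>2)"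
      by (intro sum.cong) (auto simp: r power_divide simp del: index_minus_vec)
    also have "\<dots> \<le> (\<Sum>j<n. 1 / n * (E + e)\<^sup>2)"
      using b by (intro sum_mono mult_left_mono) auto
    also have "\<dots> = (E + e)\<^sup>2" using n by simp
    finally show ?thesis .
  qed
  with ls mn have cD: "(c - D) \<bullet> (c - D) \<le> (E + e)\<^sup>2 / mn" by (simp add: field_simps)
  also have "\<dots> \<le> \<gamma> * \<kappa> * (E + e)\<^sup>2"
  proof -
    have "1 \<le> \<gamma> * mx" using mx \<gamma> by (simp add: field_simps)
    then have "1 * ((E + e)\<^sup>2 / mn) \<le> \<gamma> * mx * ((E + e)\<^sup>2 / mn)" using mn by (intro mult_right_mono) auto
    then show ?thesis by (simp add: \<kappa>)
  qed
  finally have cD: "(c - D) \<bullet> (c - D) \<le> \<gamma> * \<kappa> * (E + e)\<^sup>2" .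
  \<comment> \<open>On the open interval \<open>u\<close> is \<open>p\<close> minus the
    estimator.\<close>
  define u where "u = (\<Sum>k\<le>N. Polynomial.smult (d k - c $ k) (jacobi_onb \<alpha> k))"
  have u: "ultraspherical_integral \<alpha> (u * u) = (c - D) \<bullet> (c - D)"
    unfolding u_def parseval_jacobi_onb using cc D
    by (simp add: scalar_prod_def D_def atLeast0LessThan lessThan_Suc_atMost power2_eq_square algebra_simps)
  have "(weighted_norm \<alpha> \<alpha> (\<lambda>t. f t - ls_estimator \<alpha> \<alpha> n N x y t))\<^sup>2 \<le> 2 * E\<^sup>2 * \<gamma> + 2 * ultraspherical_integral \<alpha> (u * u)"
    unfolding \<gamma>_def
  proof (rule weighted_norm_le)
    fix t :: real assume t: "t \<in> {-1<..<1}"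
    have "ls_estimator \<alpha> \<alpha> n N x y t = (\<Sum>k\<le>N. c $ k * poly (jacobi_onb \<alpha> k) t)"
      by (simp add: ls_estimator_def c_def jacobi_normalized_eq_poly[OF \<alpha> t])
    then have "ls_estimator \<alpha> \<alpha> n N x y t + poly u t = poly p t"
      by (simp add: u_def d poly_sum left_diff_distrib sum_subtractf)
    then show "\<bar>f t - ls_estimator \<alpha> \<alpha> n N x y t - poly u t\<bar> \<le> E"
      using p(2)[of t] t by (simp add: algebra_simps)
  qed
  also have "\<dots> \<le> 2 * E\<^sup>2 * \<gamma> + 2 * (\<gamma> * \<kappa> * (E + e)\<^sup>2)" using cD u by simp
  \<comment> \<open>The left side is the sum of the squares of the two nonnegative terms on the
    right.\<close>
  also have "\<dots> \<le> (sqrt (2 * \<gamma>) * E + sqrt \<gamma> * sqrt (2 * \<kappa>) * (E + e))\<^sup>2"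
    using \<gamma> \<kappa>0 E0 e0 by (simp add: power2_sum power_mult_distrib)
  finally show "weighted_norm \<alpha> \<alpha> (\<lambda>t. f t - ls_estimator \<alpha> \<alpha> n N x y t)
      \<le> sqrt (2 * gamma_const \<alpha> \<alpha>) * E + sqrt (gamma_const \<alpha> \<alpha>) * sqrt (2 * \<kappa>) * (E + e)"
    using \<gamma> \<kappa>0 E0 e0 unfolding \<gamma>_def[symmetric] by (elim power2_le_imp_le) auto
qed

text \<open>At an end point \<open>jacobi\<close> divides by a vanishing weight and returns 0, so
  the Gram matrix consists of polynomial values only for interior samples. The density is 0 there
  because \<open>0 powr \<alpha> = 0\<close>.\<close>

lemma iid_beta_interior:
  assumes M: "prob_space M" and X: "iid_beta \<alpha> \<alpha> n M X"
  shows "\<exists>S\<in>sets M. measure M S = 1 \<and> (\<forall>\<omega>\<in>S. \<forall>i\<in>{1..n}. X i \<omega> \<in> {-1<..<1})"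
proof -
  interpret prob_space M by fact
  have AE: "AE \<omega> in M. X i \<omega> \<in> {-1<..<1}" and Xm: "X i \<in> borel_measurable M" if "i \<in> {1..n}" for i
  proof -
    have d: "distributed M lborel (X i) (\<lambda>x. ennreal (beta_density \<alpha> \<alpha> x))"
      using X that by (simp add: iid_beta_def)
    have "AE x in lborel. 0 < ennreal (beta_density \<alpha> \<alpha> x) \<longrightarrow> x \<in> {-1<..<1}"
      by (rule AE_I2) (auto simp: beta_density_def jacobi_weight_def indicator_def less_le split: if_splits)
    then show "AE \<omega> in M. X i \<omega> \<in> {-1<..<1}"
      using distributed_AE2[OF d, of "\<lambda>x. x \<in> {-1<..<1}"] by simp
    show "X i \<in> borel_measurable M" using distributed_measurable[OF d] by simp
  qed
  define S where "S = {\<omega>\<in>space M. \<forall>i\<in>{1..n}. X i \<omega> \<in> {-1<..<1}}"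
  have "S \<in> sets M"
    unfolding S_def
  proof (rule sets.sets_Collect_finite_All)
    fix i assume "i \<in> {1..n}"
    then have [measurable]: "X i \<in> borel_measurable M" by (rule Xm)
    show "{\<omega>\<in>space M. X i \<omega> \<in> {-1<..<1}} \<in> sets M" by measurable
  qed auto
  moreover have "AE \<omega> in M. \<omega> \<in> S"
  proof -
    have "AE \<omega> in M. \<forall>i\<in>{1..n}. X i \<omega> \<in> {-1<..<1}" using AE by (intro AE_finite_allI) auto
    with AE_space show ?thesis by eventually_elim (simp add: S_def)
  qed
  ultimately have "measure M S = 1" using prob_eq_1 by blast
  with \<open>S \<in> sets M\<close> show ?thesis by (intro bexI[of _ S]) (auto simp: S_def)
qed

end

section \<open>Choice of the constants and conclusion\<close>

text \<open>By \<open>q\<close> the denominator lies in \<open>(0, 3 / (2 sqrt \<gamma>)]\<close>,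
  so the fraction is at least \<open>2/3 sqrt \<gamma>\<close> times its numerator; this is the
  \<open>3 / 2\<close> in the constant. The factor \<open>K sqrt \<gamma> + 1\<close> dominates the
  coefficients of \<open>\<eta> / sqrt \<gamma>\<close> and of \<open>e\<close> in
  \<open>K \<eta> + e\<close>.\<close>

lemma least_squares_error_bound:
  fixes \<gamma> \<kappa> \<tau> \<eta> e q K W :: real
  assumes pos: "0 < \<gamma>" "0 < \<kappa>" "0 \<le> \<tau>" "0 \<le> \<eta>" "0 \<le> e" "0 \<le> K"
    and q: "\<bar>2 * \<tau> * q\<bar> \<le> 1 / (2 * sqrt \<gamma>)"
    and W: "W \<le> sqrt (2 * \<gamma>) * (K * \<eta>) + sqrt \<gamma> * sqrt (2 * \<kappa>) * (K * \<eta> + e)"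
  shows "W \<le> (sqrt (2 * \<gamma>) * K + 3 / 2 * (K * sqrt \<gamma> + 1)) *
    (\<eta> + sqrt (2 * \<kappa>) * ((\<tau> + \<eta> / sqrt \<gamma> + e) / (1 / sqrt \<gamma> - 2 * \<tau> * q)))"
proof -
  define g where "g = sqrt \<gamma>"
  define C where "C = sqrt (2 * \<gamma>) * K + 3 / 2 * (K * g + 1)"
  define u where "u = \<tau> + \<eta> / g + e"
  define D where "D = 1 / g - 2 * \<tau> * q"
  have g: "0 < g" using pos by (simp add: g_def)
  have "0 \<le> sqrt (2 * \<gamma>) * K" using pos by simp
  then have C: "sqrt (2 * \<gamma>) * K \<le> C" "3 / 2 * (K * g + 1) \<le> C" "0 \<le> C"
    using pos g by (simp_all add: C_def add_nonneg_nonneg)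
  have "1 / (2 * g) = 1 / g / 2" by simp
  then have D: "0 < D" "D \<le> 3 / (2 * g)"
  proof -
    have "3 / (2 * g) = 1 / g + 1 / g / 2" "0 < 1 / g" using g by (simp_all add: field_simps)
    then show "0 < D" "D \<le> 3 / (2 * g)"
      using q \<open>1 / (2 * g) = 1 / g / 2\<close> unfolding D_def g_def[symmetric] by linarith+
  qed
  have u0: "0 \<le> u" using pos g by (simp add: u_def)
  have "2 / 3 * g * u \<le> u / D"
  proof -
    have "u / (3 / (2 * g)) \<le> u / D" using D u0 g by (intro divide_left_mono) auto
    then show ?thesis by (simp add: field_simps)
  qed
  then have "C * (2 / 3 * g * u) \<le> C * (u / D)" using C by (intro mult_left_mono)
  moreover have "g * (K * \<eta> + e) \<le> C * (2 / 3 * g * u)"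
  proof -
    have "K * \<eta> + e = K * g * (\<eta> / g) + 1 * e" using g by simp
    also have "\<dots> \<le> (K * g + 1) * (\<eta> / g) + (K * g + 1) * e"
      using pos g by (intro add_mono mult_right_mono) auto
    also have "\<dots> = (K * g + 1) * (\<eta> / g + e)" by (simp add: distrib_left)
    also have "\<dots> \<le> (2 / 3 * C) * u"
      using C pos g by (intro mult_mono) (auto simp: u_def)
    finally have "g * (K * \<eta> + e) \<le> g * ((2 / 3 * C) * u)" using g by (intro mult_left_mono) auto
    then show ?thesis by (simp add: mult_ac)
  qed
  ultimately have "g * (K * \<eta> + e) \<le> C * (u / D)" by linarith
  then have "sqrt (2 * \<kappa>) * (g * (K * \<eta> + e)) \<le> sqrt (2 * \<kappa>) * (C * (u / D))"
    using pos by (intro mult_left_mono) auto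
  moreover have "sqrt (2 * \<gamma>) * K * \<eta> \<le> C * \<eta>" using C pos by (intro mult_right_mono) auto
  ultimately have "W \<le> C * \<eta> + sqrt (2 * \<kappa>) * (C * (u / D))"
    using W unfolding g_def[symmetric] by (simp add: mult_ac)
  also have "\<dots> = C * (\<eta> + sqrt (2 * \<kappa>) * (u / D))" by (simp add: distrib_left mult_ac)
  finally show ?thesis unfolding C_def u_def D_def g_def .
qed

theorem corollary2:
  fixes \<alpha> \<beta> :: real
  assumes "\<beta> = \<alpha>" and "\<alpha> \<ge> - 1 / 2"
  shows "\<exists>C\<alpha>>0. \<forall>(c::real) (fbar :: real \<Rightarrow> real) (f :: real \<Rightarrow> real) (\<sigma>::real).
    c > 0 \<longrightarrow> bandlimited c fbar \<longrightarrow> (\<forall>x\<in>{-1..1}. f x = fbar x) \<longrightarrow>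
    (\<forall>\<delta>::real. 0 < \<delta> \<longrightarrow> \<delta> < 1 \<longrightarrow>
      (\<exists>C::real. C > 0 \<and> (\<exists>n0 N0 :: nat. \<forall>n N :: nat.
        n \<ge> n0 \<longrightarrow> N \<ge> N0 \<longrightarrow> n > N \<longrightarrow>
        0.63 * real n > m_squared \<alpha> \<beta> * real (N + 1) powr (2 * \<alpha> + 2) * ln (real (N + 1)) \<longrightarrow>
        (\<forall>(M :: 'a measure) (X :: nat \<Rightarrow> 'a \<Rightarrow> real) (\<epsilon> :: nat \<Rightarrow> 'a \<Rightarrow> real).
          prob_space M \<longrightarrow> iid_beta \<alpha> \<beta> n M X \<longrightarrow> iid_centered \<sigma> n M \<epsilon> \<longrightarrow>
          (\<exists>E\<in>sets M. measure M E \<ge> (1 - \<delta>)\<^sup>2 \<and> (\<forall>\<omega>\<in>E.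
            let x = (\<lambda>i. X i \<omega>);
                y = (\<lambda>i. f (X i \<omega>) + \<epsilon> i \<omega>);
                fhat = ls_estimator \<alpha> \<beta> n N x y;
                \<kappa> = cond_number (gram_matrix \<alpha> \<beta> n N x);
                \<eta> = bandlimited_rate C\<alpha> c N * L2_norm_real fbar;
                noise = Max ((\<lambda>i. \<bar>\<epsilon> i \<omega>\<bar>) ` {1..n});
                \<tau> = (1 / real n * ln (2 / \<delta>)) powr (1 / 4);
                numer = \<tau> + \<eta> / sqrt (gamma_const \<alpha> \<beta>) + noise;
                denom = 1 / sqrt (gamma_const \<alpha> \<beta>) - 2 * \<tau> * (sup_norm f / weighted_norm \<alpha> \<beta> f)
            in ereal (weighted_norm \<alpha> \<beta> (\<lambda>t. f t - fhat t))
                 \<le> ereal C * (ereal \<eta> + ereal_sqrt (2 * \<kappa>) * ereal (numer / denom))))))))"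
proof -
  define \<gamma> where "\<gamma> = gamma_const \<alpha> \<alpha>"
  have \<gamma>: "0 < \<gamma>" unfolding \<gamma>_def by (rule gamma_const_pos[OF assms(2)])
  show ?thesis
    unfolding \<open>\<beta> = \<alpha>\<close>
  \<comment> \<open>With \<open>C\<alpha> = 1\<close> all constants of the approximation go into
    \<open>C\<close>, which is chosen for given \<open>c\<close> and \<open>fbar\<close>.\<close>
  proof (rule exI[of _ 1], intro conjI allI impI)
    fix c :: real and fbar f :: "real \<Rightarrow> real" and \<sigma> \<delta> :: real
    assume c: "0 < c" and bl: "bandlimited c fbar" and f: "\<forall>x\<in>{-1..1}. f x = fbar x"
      and \<delta>: "0 < \<delta>" "\<delta> < 1"
    obtain K where K: "0 \<le> K" and approx: "\<And>N. \<exists>p. Polynomial.degree p \<le> N \<and>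
        (\<forall>x. \<bar>x\<bar> \<le> 1 \<longrightarrow> \<bar>fbar x - poly p x\<bar> \<le> K * (bandlimited_rate 1 c N * L2_norm_real fbar))"
      using bandlimited_polynomial_approximation[OF bl c] by blast
    define C where "C = sqrt (2 * \<gamma>) * K + 3 / 2 * (K * sqrt \<gamma> + 1)"
    have C: "0 < C" using K \<gamma> by (simp add: C_def add_nonneg_pos)
    define q where "q = sup_norm f / weighted_norm \<alpha> \<alpha> f"
    define \<tau> where "\<tau> n = (1 / real n * ln (2 / \<delta>)) powr (1 / 4)" for n :: nat
    have "(\<lambda>n. 1 / real n * ln (2 / \<delta>)) \<longlonglongrightarrow> 0 * ln (2 / \<delta>)"
      by (intro tendsto_mult_right lim_1_over_n)
    then have "\<tau> \<longlonglongrightarrow> 0 powr (1 / 4)"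
      unfolding \<tau>_def using \<delta> by (intro tendsto_powr') (auto intro!: always_eventually)
    then have "(\<lambda>n. 2 * \<tau> n * q) \<longlonglongrightarrow> 0"
      by (auto intro!: tendsto_eq_intros)
    \<comment> \<open>The threshold is half the limit of the denominator, which therefore stays
      between 1/2 and 3/2 of its limit from \<open>n0\<close> on.\<close>
    from LIMSEQ_D[OF this, of "1 / (2 * sqrt \<gamma>)"] \<gamma>
    obtain n0 where n0: "\<And>n. n \<ge> n0 \<Longrightarrow> \<bar>2 * \<tau> n * q\<bar> < 1 / (2 * sqrt \<gamma>)"
      by (auto simp: abs_mult)
    have main: "ereal (weighted_norm \<alpha> \<alpha> (\<lambda>t. f t - ls_estimator \<alpha> \<alpha> n N (\<lambda>i. X i \<omega>) (\<lambda>i. f (X i \<omega>) + \<epsilon> i \<omega>) t))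
        \<le> ereal C * (ereal (bandlimited_rate 1 c N * L2_norm_real fbar) +
          ereal_sqrt (2 * cond_number (gram_matrix \<alpha> \<alpha> n N (\<lambda>i. X i \<omega>))) *
          ereal ((\<tau> n + bandlimited_rate 1 c N * L2_norm_real fbar / sqrt \<gamma> + Max ((\<lambda>i. \<bar>\<epsilon> i \<omega>\<bar>) ` {1..n})) /
            (1 / sqrt \<gamma> - 2 * \<tau> n * q)))"
      if n: "n \<ge> n0" "0 < n" and X: "\<forall>i\<in>{1..n}. X i \<omega> \<in> {-1<..<1}"
      for n N and X \<epsilon> :: "nat \<Rightarrow> 'a \<Rightarrow> real" and \<omega>
    proof -
      let ?x = "\<lambda>i. X i \<omega>" and ?y = "\<lambda>i. f (X i \<omega>) + \<epsilon> i \<omega>"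
      define \<eta> where "\<eta> = bandlimited_rate 1 c N * L2_norm_real fbar"
      define e where "e = Max ((\<lambda>i. \<bar>\<epsilon> i \<omega>\<bar>) ` {1..n})"
      define u where "u = \<tau> n + \<eta> / sqrt \<gamma> + e"
      define D where "D = 1 / sqrt \<gamma> - 2 * \<tau> n * q"
      have \<eta>: "0 \<le> \<eta>" using c by (simp add: \<eta>_def bandlimited_rate_def L2_norm_real_def)
      have eps: "\<bar>\<epsilon> i \<omega>\<bar> \<le> e" if "i \<in> {1..n}" for i
        unfolding e_def using that by (intro Max_ge) auto
      have e: "0 \<le> e" using eps[of 1] n by fastforce
      have \<tau>: "0 < \<tau> n" using \<delta> n by (simp add: \<tau>_def)
      have q: "\<bar>2 * \<tau> n * q\<bar> < 1 / (2 * sqrt \<gamma>)" using n0 n by blast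
      have "1 / (2 * sqrt \<gamma>) = 1 / sqrt \<gamma> / 2" by simp
      moreover have "0 < 1 / sqrt \<gamma>" using \<gamma> by simp
      ultimately have D: "0 < D" using q unfolding D_def by linarith
      have u: "0 < u" using \<tau> \<eta> e \<gamma> by (simp add: u_def add_pos_nonneg)
      show ?thesis
      proof (cases "invertible_mat (gram_matrix \<alpha> \<alpha> n N ?x)")
        case False
        \<comment> \<open>The right side is infinite only because \<open>u / D\<close> is strictly
          positive, as \<open>0 * \<infinity> = 0\<close> in \<open>ereal\<close>; the summand
          \<open>\<tau> n > 0\<close> ensures this even when noise and rate vanish.\<close>
        then have "ereal_sqrt (2 * cond_number (gram_matrix \<alpha> \<alpha> n N ?x)) = \<infinity>"
          by (simp add: cond_number_def ereal_sqrt_def)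
        then show ?thesis
          using C u D unfolding \<eta>_def[symmetric] e_def[symmetric] u_def[symmetric] D_def[symmetric] by simp
      next
        case True
        obtain p where p: "Polynomial.degree p \<le> N" "\<And>x. \<bar>x\<bar> \<le> 1 \<Longrightarrow> \<bar>fbar x - poly p x\<bar> \<le> K * \<eta>"
          using approx[of N] unfolding \<eta>_def by blast
        define \<kappa> where "\<kappa> = Max (Collect (eigenvalue (gram_matrix \<alpha> \<alpha> n N ?x))) / Min (Collect (eigenvalue (gram_matrix \<alpha> \<alpha> n N ?x)))"
        have fp: "\<bar>f t - poly p t\<bar> \<le> K * \<eta>" if "t \<in> {-1..1}" for t
          using p(2)[of t] f that by (auto simp: abs_le_iff)
        have \<kappa>: "0 < \<kappa>"
          and W: "weighted_norm \<alpha> \<alpha> (\<lambda>t. f t - ls_estimator \<alpha> \<alpha> n N ?x ?y t)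
            \<le> sqrt (2 * \<gamma>) * (K * \<eta>) + sqrt \<gamma> * sqrt (2 * \<kappa>) * (K * \<eta> + e)"
        proof -
          have y: "\<bar>?y j - f (?x j)\<bar> \<le> e" if "j \<in> {1..n}" for j using eps[OF that] by simp
          note * = least_squares_estimator_error[OF assms(2) n(2) _ p(1) fp y True, folded \<kappa>_def \<gamma>_def]
          show "0 < \<kappa>" by (rule *(1)) (use X in auto)
          show "weighted_norm \<alpha> \<alpha> (\<lambda>t. f t - ls_estimator \<alpha> \<alpha> n N ?x ?y t)
            \<le> sqrt (2 * \<gamma>) * (K * \<eta>) + sqrt \<gamma> * sqrt (2 * \<kappa>) * (K * \<eta> + e)"
            by (rule *(2)) (use X in auto)
        qed
        have "weighted_norm \<alpha> \<alpha> (\<lambda>t. f t - ls_estimator \<alpha> \<alpha> n N ?x ?y t) \<le> C * (\<eta> + sqrt (2 * \<kappa>) * (u / D))"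
          unfolding C_def u_def D_def using \<gamma> \<kappa> \<tau> \<eta> e K q W
          by (intro least_squares_error_bound) auto
        moreover have "cond_number (gram_matrix \<alpha> \<alpha> n N ?x) = ereal \<kappa>"
          using True by (simp add: cond_number_def \<kappa>_def)
        moreover have "ereal_sqrt (2 * ereal \<kappa>) = ereal (sqrt (2 * \<kappa>))"
          unfolding ereal_sqrt_def times_ereal.simps numeral_eq_ereal[symmetric] by simp
        ultimately show ?thesis
          unfolding \<eta>_def[symmetric] e_def[symmetric] u_def[symmetric] D_def[symmetric] by simp
      qed
    qed
    show "\<exists>C>0. \<exists>n0 N0. \<forall>n N. n0 \<le> n \<longrightarrow> N0 \<le> N \<longrightarrow> N < n \<longrightarrow>
        m_squared \<alpha> \<alpha> * real (N + 1) powr (2 * \<alpha> + 2) * ln (real (N + 1)) < 0.63 * real n \<longrightarrow>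
        (\<forall>(M :: 'a measure) (X :: nat \<Rightarrow> 'a \<Rightarrow> real) (\<epsilon> :: nat \<Rightarrow> 'a \<Rightarrow> real).
          prob_space M \<longrightarrow> iid_beta \<alpha> \<alpha> n M X \<longrightarrow> iid_centered \<sigma> n M \<epsilon> \<longrightarrow>
          (\<exists>E\<in>sets M. (1 - \<delta>)\<^sup>2 \<le> measure M E \<and> (\<forall>\<omega>\<in>E.
            let x = (\<lambda>i. X i \<omega>);
                y = (\<lambda>i. f (X i \<omega>) + \<epsilon> i \<omega>);
                fhat = ls_estimator \<alpha> \<alpha> n N x y;
                \<kappa> = cond_number (gram_matrix \<alpha> \<alpha> n N x);
                \<eta> = bandlimited_rate 1 c N * L2_norm_real fbar;
                noise = Max ((\<lambda>i. \<bar>\<epsilon> i \<omega>\<bar>) ` {1..n});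
                \<tau> = (1 / real n * ln (2 / \<delta>)) powr (1 / 4);
                numer = \<tau> + \<eta> / sqrt (gamma_const \<alpha> \<alpha>) + noise;
                denom = 1 / sqrt (gamma_const \<alpha> \<alpha>) - 2 * \<tau> * (sup_norm f / weighted_norm \<alpha> \<alpha> f)
            in ereal (weighted_norm \<alpha> \<alpha> (\<lambda>t. f t - fhat t))
                 \<le> ereal C * (ereal \<eta> + ereal_sqrt (2 * \<kappa>) * ereal (numer / denom)))))"
    proof (rule exI[of _ C], rule conjI[OF C], rule exI[of _ n0], rule exI[of _ 0], intro allI impI)
      fix n N :: nat and M :: "'a measure" and X \<epsilon> :: "nat \<Rightarrow> 'a \<Rightarrow> real"
      assume n: "n0 \<le> n" "N < n" and M: "prob_space M" and X: "iid_beta \<alpha> \<alpha> n M X"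
      obtain S where S: "S \<in> sets M" "measure M S = 1" "\<forall>\<omega>\<in>S. \<forall>i\<in>{1..n}. X i \<omega> \<in> {-1<..<1}"
        using iid_beta_interior[OF assms(2) M X] by blast
      have "(1 - \<delta>)\<^sup>2 \<le> 1" using \<delta> by (intro power_le_one) auto
      then show "\<exists>E\<in>sets M. (1 - \<delta>)\<^sup>2 \<le> measure M E \<and> (\<forall>\<omega>\<in>E.
            let x = (\<lambda>i. X i \<omega>);
                y = (\<lambda>i. f (X i \<omega>) + \<epsilon> i \<omega>);
                fhat = ls_estimator \<alpha> \<alpha> n N x y;
                \<kappa> = cond_number (gram_matrix \<alpha> \<alpha> n N x);
                \<eta> = bandlimited_rate 1 c N * L2_norm_real fbar;
                noise = Max ((\<lambda>i. \<bar>\<epsilon> i \<omega>\<bar>) ` {1..n});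
                \<tau> = (1 / real n * ln (2 / \<delta>)) powr (1 / 4);
                numer = \<tau> + \<eta> / sqrt (gamma_const \<alpha> \<alpha>) + noise;
                denom = 1 / sqrt (gamma_const \<alpha> \<alpha>) - 2 * \<tau> * (sup_norm f / weighted_norm \<alpha> \<alpha> f)
            in ereal (weighted_norm \<alpha> \<alpha> (\<lambda>t. f t - fhat t))
                 \<le> ereal C * (ereal \<eta> + ereal_sqrt (2 * \<kappa>) * ereal (numer / denom)))"
        using S n main[of n X _ N \<epsilon>, unfolded \<tau>_def \<gamma>_def q_def]
        by (intro bexI[of _ S]) (auto simp: Let_def)
    qed
  qed simp
qed

end
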